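(* Let $G=(V,E,\mathbf{w},\boldsymbol{\mu})$ be a submodular hypergraph with $V=\{1,\dots,N\}$, and let $\zeta(E)=\max_{e\in E}|e|$. Suppose that $x$ is the output of the following algorithm (Algorithm 1): solve the SDP relaxation described in the context, obtaining an optimal matrix $X\in\mathbb{R}^{n\times N}$ (with $n\ge\zeta(E)$); generate a random Gaussian vector $g\sim N(0,I_n)$, where $I_n$ is the identity matrix of order $n$; output $x=X^Tg$. Then, with high probability, $$c(x)\le O\!\left(\sqrt{\zeta(E)\,\tau\,h_2}\right),\qquad \tau=\max_{v\in V}\frac{d_v}{\mu_v}.$$
   Context: Submodular hypergraph: $V=[N]=\{1,\dots,N\}$; $E\subseteq 2^V$ is a set of hyperedges; each vertex has a weight $\mu_v>0$; each $e\in E$ carries a scalar $\vartheta_e>0$ and a function $w_e:2^e\to[0,1]$ that is submodular ($w_e(S)+w_e(T)\ge w_e(S\cup T)+w_e(S\cap T)$), satisfies $w_e(\emptyset)=0$, is symmetric ($w_e(S)=w_e(e\setminus S)$), and is normalized (the original cut weights of $e$ are divided by their maximum $\vartheta_e$, so that $\max_{S\subseteq e}w_e(S)=1$); $v\in e$ if and only if $w_e(\{v\})>0$. For $S\subseteq V$ put $w_e(S):=w_e(S\cap e)$. The degree is $d_v=\sum_{e\in E:\,v\in e}\vartheta_e$; $\mathrm{vol}(S)=\sum_{v\in S}\mu_v$; $\mathrm{vol}(\partial S)=\sum_{e\in E}\vartheta_e w_e(S)$; the Cheeger constant is $h_2=\min_{\emptyset\neq S\subsetneq V}\mathrm{vol}(\partial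 S)/\min\{\mathrm{vol}(S),\mathrm{vol}(V\setminus S)\}$. Base polytope: $\mathcal{B}_e=\{y\in\mathbb{R}^N: y(S)\le w_e(S)\ \forall S\subseteq V,\ y(V)=0\}$ with $y(S)=\sum_{v\in S}y_v$; $\mathcal{E}(\mathcal{B}_e)$ is its set of extreme points. SDP relaxation: over matrices $X=(x'_1,\dots,x'_N)\in\mathbb{R}^{n\times N}$ (columns $x'_v\in\mathbb{R}^n$, $n\ge\zeta(E)$) and $\eta\in\mathbb{R}^{|E|}$, minimize $\sum_{e\in E}\vartheta_e\eta_e^2$ subject to $\|Xy\|_2^2\le\eta_e^2$ for all $e\in E$ and $y\in\mathcal{E}(\mathcal{B}_e)$, $\sum_{v\in V}\mu_v\|x'_v\|_2^2=1$, and $\sum_{v\in V}\mu_v x'_v=0$. For nonconstant $x\in\mathbb{R}^N$ and a threshold $\theta$, $\Theta(x,\theta)=\{v:x_v>\theta\}$, and the optimal conductance obtained from thresholding $x$ is $$c(x)=\inf_{\theta\in[x_{\min},x_{\max})}\frac{\mathrm{vol}(\partial\Theta(x,\theta))}{\min\{\mathrm{vol}(\Theta(x,\theta)),\mathrm{vol}(V\setminus\Theta(x,\theta))\}},$$ where $x_{\min},x_{\max}$ are the smallest and largest entries of $x$. The probability is over the random vector $g$. *)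

theory Defs
  imports "HOL-Probability.Probability"
begin

text \<open>
  A hypergraph on the vertex set \<open>{1..N}\<close>. The field \<open>cut G e S\<close> is the normalized cut weight
  \<open>w\<^sub>e(S)\<close>; only its values for \<open>e \<in> edges G\<close> and \<open>S \<subseteq> e\<close> matter, so every use for a general
  vertex set \<open>S\<close> is written \<open>cut G e (S \<inter> e)\<close>.
\<close>

record hypergraph =
  num_verts :: nat
  edges :: "nat set set"
  cut :: "nat set \<Rightarrow> nat set \<Rightarrow> real"
  scale :: "nat set \<Rightarrow> real"  \<comment> \<open>\<open>\<vartheta>\<^sub>e\<close>\<close>
  mu :: "nat \<Rightarrow> real"

definition verts :: "hypergraph \<Rightarrow> nat set" where
  "verts G = {1..num_verts G}"

locale submodular_hypergraph =
  fixes G :: hypergraph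
  assumes edges_subset: "edges G \<subseteq> Pow (verts G)"
    and mu_pos: "v \<in> verts G \<Longrightarrow> mu G v > 0"
    and scale_pos: "e \<in> edges G \<Longrightarrow> scale G e > 0"
    and cut_range: "\<lbrakk>e \<in> edges G; S \<subseteq> e\<rbrakk> \<Longrightarrow> cut G e S \<in> {0..1}"
    and cut_submodular: "\<lbrakk>e \<in> edges G; S \<subseteq> e; T \<subseteq> e\<rbrakk>
          \<Longrightarrow> cut G e S + cut G e T \<ge> cut G e (S \<union> T) + cut G e (S \<inter> T)"
    and cut_empty: "e \<in> edges G \<Longrightarrow> cut G e {} = 0"
    and cut_symmetric: "\<lbrakk>e \<in> edges G; S \<subseteq> e\<rbrakk> \<Longrightarrow> cut G e S = cut G e (e - S)"
    and cut_normalized: "e \<in> edges G \<Longrightarrow> Max (cut G e ` Pow e) = 1"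
    and cut_incidence: "\<lbrakk>e \<in> edges G; v \<in> verts G\<rbrakk> \<Longrightarrow> v \<in> e \<longleftrightarrow> cut G e ({v} \<inter> e) > 0"

definition degree :: "hypergraph \<Rightarrow> nat \<Rightarrow> real" where
  "degree G v = (\<Sum>e | e \<in> edges G \<and> v \<in> e. scale G e)"

definition vol :: "hypergraph \<Rightarrow> nat set \<Rightarrow> real" where
  "vol G S = (\<Sum>v\<in>S. mu G v)"

definition vol_boundary :: "hypergraph \<Rightarrow> nat set \<Rightarrow> real" where
  "vol_boundary G S = (\<Sum>e\<in>edges G. scale G e * cut G e (S \<inter> e))"

definition conductance :: "hypergraph \<Rightarrow> nat set \<Rightarrow> real" where
  "conductance G S = vol_boundary G S / min (vol G S) (vol G (verts G - S))"

definition cheeger :: "hypergraph \<Rightarrow> real" where  \<comment> \<open>\<open>h\<^sub>2\<close>\<close>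
  "cheeger G = Min (conductance G ` {S. S \<noteq> {} \<and> S \<subset> verts G})"

text \<open>The element \<open>0\<close> below only fixes the value of the maximum for a hypergraph without edges.\<close>

definition zeta :: "hypergraph \<Rightarrow> nat" where
  "zeta G = Max (insert 0 (card ` edges G))"

definition tau :: "hypergraph \<Rightarrow> real" where
  "tau G = Max ((\<lambda>v. degree G v / mu G v) ` verts G)"

text \<open>
  Vectors in \<open>\<real>\<^sup>N\<close> are functions on \<open>nat\<close> that vanish outside the vertex set.
\<close>

definition base_polytope :: "hypergraph \<Rightarrow> nat set \<Rightarrow> (nat \<Rightarrow> real) set" where
  "base_polytope G e = {y. (\<forall>v. v \<notin> verts G \<longrightarrow> y v = 0)
      \<and> (\<forall>S\<subseteq>verts G. (\<Sum>v\<in>S. y v) \<le> cut G e (S \<inter> e))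
      \<and> (\<Sum>v\<in>verts G. y v) = 0}"

text \<open>
  This is \<^const>\<open>extreme_point_of\<close> (with \<^const>\<open>open_segment\<close> unfolded) for sets of real functions,
  which are not an instance of \<^class>\<open>real_vector\<close>.
\<close>

definition extreme_points :: "(nat \<Rightarrow> real) set \<Rightarrow> (nat \<Rightarrow> real) set" where
  "extreme_points B = {y \<in> B. \<forall>a\<in>B. \<forall>b\<in>B.
      \<not> (a \<noteq> b \<and> (\<exists>u. 0 < u \<and> u < 1 \<and> y = (\<lambda>v. (1 - u) * a v + u * b v)))}"

text \<open>
  A matrix \<open>X \<in> \<real>\<^sup>n\<^sup>\<times>\<^sup>N\<close> is a function with entries \<open>X i v\<close>, of which only those with
  \<open>i \<in> {1..n}\<close> and \<open>v \<in> {1..N}\<close> are ever used; the column \<open>x'\<^sub>v\<close> is \<open>\<lambda>i. X i v\<close>.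
\<close>

definition sq_norm :: "nat \<Rightarrow> (nat \<Rightarrow> real) \<Rightarrow> real" where
  "sq_norm n z = (\<Sum>i\<in>{1..n}. (z i)\<^sup>2)"

definition mat_vec :: "hypergraph \<Rightarrow> (nat \<Rightarrow> nat \<Rightarrow> real) \<Rightarrow> (nat \<Rightarrow> real) \<Rightarrow> nat \<Rightarrow> real" where
  "mat_vec G X y = (\<lambda>i. \<Sum>v\<in>verts G. X i v * y v)"

definition sdp_feasible ::
  "hypergraph \<Rightarrow> nat \<Rightarrow> (nat \<Rightarrow> nat \<Rightarrow> real) \<Rightarrow> (nat set \<Rightarrow> real) \<Rightarrow> bool" where
  "sdp_feasible G n X \<eta> \<longleftrightarrow>
     (\<forall>e\<in>edges G. \<forall>y\<in>extreme_points (base_polytope G e). sq_norm n (mat_vec G X y) \<le> (\<eta> e)\<^sup>2)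
     \<and> (\<Sum>v\<in>verts G. mu G v * sq_norm n (\<lambda>i. X i v)) = 1
     \<and> (\<forall>i\<in>{1..n}. (\<Sum>v\<in>verts G. mu G v * X i v) = 0)"

definition sdp_objective :: "hypergraph \<Rightarrow> (nat set \<Rightarrow> real) \<Rightarrow> real" where
  "sdp_objective G \<eta> = (\<Sum>e\<in>edges G. scale G e * (\<eta> e)\<^sup>2)"

definition sdp_optimal ::
  "hypergraph \<Rightarrow> nat \<Rightarrow> (nat \<Rightarrow> nat \<Rightarrow> real) \<Rightarrow> (nat set \<Rightarrow> real) \<Rightarrow> bool" where
  "sdp_optimal G n X \<eta> \<longleftrightarrow> sdp_feasible G n X \<eta>
     \<and> (\<forall>X' \<eta>'. sdp_feasible G n X' \<eta>' \<longrightarrow> sdp_objective G \<eta> \<le> sdp_objective G \<eta>')"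

definition gaussian :: "nat \<Rightarrow> (nat \<Rightarrow> real) measure" where  \<comment> \<open>\<open>N(0, I\<^sub>n)\<close>\<close>
  "gaussian n = (\<Pi>\<^sub>M i\<in>{1..n}. std_normal_distribution)"

definition rounding :: "nat \<Rightarrow> (nat \<Rightarrow> nat \<Rightarrow> real) \<Rightarrow> (nat \<Rightarrow> real) \<Rightarrow> nat \<Rightarrow> real" where
  "rounding n X g = (\<lambda>v. \<Sum>i\<in>{1..n}. X i v * g i)"  \<comment> \<open>\<open>X\<^sup>T g\<close>\<close>

definition nonconstant :: "hypergraph \<Rightarrow> (nat \<Rightarrow> real) \<Rightarrow> bool" where
  "nonconstant G x \<longleftrightarrow> (\<exists>u\<in>verts G. \<exists>v\<in>verts G. x u \<noteq> x v)"

definition threshold_set :: "hypergraph \<Rightarrow> (nat \<Rightarrow> real) \<Rightarrow> real \<Rightarrow> nat set" where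
  "threshold_set G x \<theta> = {v \<in> verts G. x v > \<theta>}"

text \<open>
  Meaningful for nonconstant \<open>x\<close> only: otherwise the infimum is over the empty set.
\<close>

definition threshold_conductance :: "hypergraph \<Rightarrow> (nat \<Rightarrow> real) \<Rightarrow> real" where  \<comment> \<open>\<open>c(x)\<close>\<close>
  "threshold_conductance G x =
     (INF \<theta>\<in>{Min (x ` verts G)..<Max (x ` verts G)}. conductance G (threshold_set G x \<theta>))"

end

theory Submission
  imports Defs
begin

text \<open>
  A Cheeger-type rounding argument. Sorting the vertices by \<open>x\<close> gives for every edge \<open>e\<close> an extreme point
  \<open>y\<^sub>e\<close> of the base polytope (Edmonds' greedy vector). With \<open>m\<close> a weighted median of \<open>x\<close>, summation by
  parts of \<open>\<Sum>\<^sub>e \<vartheta>\<^sub>e \<langle>y\<^sub>e, q\<rangle>\<close> for \<open>q v = (x v - m) \<bar>x v - m\<bar>\<close> shows that it is at least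
  \<open>c(x) \<Sum>\<^sub>v \<mu>\<^sub>v (x v - m)\<^sup>2\<close>, while monotonicity and the Cauchy--Schwarz inequality bound it from above, so that
  \<open>c(x)\<^sup>2 \<le> 4 \<tau> (\<Sum>\<^sub>e \<vartheta>\<^sub>e \<langle>y\<^sub>e, x\<rangle>\<^sup>2) / (\<Sum>\<^sub>v \<mu>\<^sub>v (x v)\<^sup>2)\<close> whenever \<open>x\<close> has weighted mean 0.

  For \<open>x = X\<^sup>T g\<close> the numerator has expectation at most \<open>\<zeta>(E)\<close> times the SDP optimum, because only the
  projection of \<open>g\<close> to the span of the columns of \<open>X\<close> in \<open>e\<close> contributes, and the SDP optimum is at most
  \<open>2 h\<^sub>2\<close>; Markov's inequality controls it. The denominator \<open>D\<close> has mean 1 and is a convex combination of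
  squares of standard Gaussians, so \<open>E exp(-t D) \<le> 1 / sqrt (1 + 2 t)\<close> by Jensen's inequality and \<open>D\<close> is
  unlikely to be small.
\<close>

section \<open>Gaussian vectors\<close>

lemma prob_space_gaussian: "prob_space (gaussian n)"
  unfolding gaussian_def by (intro prob_space_PiM prob_space_normal_density) simp

lemma measurable_gaussian_component:
  "i \<in> {1..n} \<Longrightarrow> (\<lambda>g. g i) \<in> borel_measurable (gaussian n)"
  unfolding gaussian_def by measurable

lemma borel_measurable_rounding[measurable]:
  "(\<lambda>g. rounding n X g v) \<in> borel_measurable (gaussian n)"
  unfolding rounding_def
  by (intro borel_measurable_sum borel_measurable_times borel_measurable_const
      measurable_gaussian_component)

lemma distributed_component:
  assumes "i \<in> {1..n}"
  shows "distributed (gaussian n) lborel (\<lambda>g. g i) std_normal_density"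
proof -
  have "distr (gaussian n) std_normal_distribution (\<lambda>g. g i) = std_normal_distribution"
    unfolding gaussian_def
    by (rule distr_PiM_component[OF _ assms]) (rule prob_space_normal_density, simp)
  moreover have "distr (gaussian n) std_normal_distribution (\<lambda>g. g i) = distr (gaussian n) lborel (\<lambda>g. g i)"
    by (rule distr_cong) simp_all
  ultimately show ?thesis
    using measurable_gaussian_component[OF assms] by (auto simp: distributed_def)
qed

lemma indep_components:
  "prob_space.indep_vars (gaussian n) (\<lambda>_. borel) (\<lambda>i g. g i) {1..n}"
proof -
  interpret prob_space "gaussian n" by (rule prob_space_gaussian)
  have *: "distr (gaussian n) borel (\<lambda>g. g i) = std_normal_distribution" if "i \<in> {1..n}" for i
  proof -
    have "distr (gaussian n) borel (\<lambda>g. g i) = distr (gaussian n) lborel (\<lambda>g. g i)"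
      by (rule distr_cong) simp_all
    then show ?thesis
      using distributed_component[OF that] by (simp add: distributed_def)
  qed
  show ?thesis
  \<comment> \<open>The characterisation of independence by a product law is stated for nonempty
    index sets, so \<open>n = 0\<close> is split off.\<close>
  proof (cases "n = 0")
    case False
    have "distr (gaussian n) (\<Pi>\<^sub>M i\<in>{1..n}. borel) (\<lambda>x. \<lambda>i\<in>{1..n}. x i) = gaussian n"
    proof -
      have "distr (gaussian n) (\<Pi>\<^sub>M i\<in>{1..n}. borel) (\<lambda>x. \<lambda>i\<in>{1..n}. x i) = distr (gaussian n) (gaussian n) (\<lambda>x. x)"
        by (rule distr_cong)
           (auto simp: space_PiM gaussian_def restrict_def PiE_iff extensional_def fun_eq_iff
              intro!: sets_PiM_cong)
      then show ?thesis by simp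
    qed
    also have "\<dots> = (\<Pi>\<^sub>M i\<in>{1..n}. distr (gaussian n) borel (\<lambda>g. g i))"
      unfolding gaussian_def[of n] by (rule PiM_cong) (use * in \<open>auto simp: gaussian_def\<close>)
    finally show ?thesis
      using False by (subst indep_vars_iff_distr_eq_PiM') (auto simp del: One_nat_def intro: measurable_gaussian_component)
  next
    case True
    have "indep_vars (\<lambda>_. borel) (\<lambda>i g. g i) ({} :: nat set)"
      by (simp add: indep_vars_def indep_sets_def)
    then show ?thesis using True by simp
  qed
qed

text \<open>Rotation invariance: a sum of independent centred normals is normal, and the variances
  \<open>(a i)\<^sup>2\<close> add up to 1.\<close>

lemma distributed_linear:
  assumes a: "sq_norm n a = 1"
  shows "distributed (gaussian n) lborel (\<lambda>g. \<Sum>i\<in>{1..n}. a i * g i) std_normal_density"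
proof -
  interpret prob_space "gaussian n" by (rule prob_space_gaussian)
  \<comment> \<open>Zero coefficients are dropped because the summands must have positive standard
    deviation \<open>\<bar>a i\<bar>\<close>.\<close>
  let ?I = "{i\<in>{1..n}. a i \<noteq> 0}"
  have sq: "(\<Sum>i\<in>?I. (a i)\<^sup>2) = 1"
    using a unfolding sq_norm_def by (subst (asm) sum.mono_neutral_right[of _ ?I]) auto
  have "distributed (gaussian n) lborel (\<lambda>g. \<Sum>i\<in>?I. a i * g i)
      (normal_density (\<Sum>i\<in>?I. 0) (sqrt (\<Sum>i\<in>?I. \<bar>a i\<bar>\<^sup>2)))"
  proof (rule sum_indep_normal)
    show "?I \<noteq> {}" using sq by (metis sum.empty zero_neq_one)
    show "indep_vars (\<lambda>i. borel) (\<lambda>i g. a i * g i) ?I"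
      by (rule indep_vars_compose2[OF indep_vars_subset[OF indep_components]]) auto
    show "distributed (gaussian n) lborel (\<lambda>g. a i * g i) (normal_density 0 \<bar>a i\<bar>)" if "i \<in> ?I" for i
      using normal_density_affine[OF distributed_component[of i n], of "a i" 0] that by auto
  qed auto
  moreover have "(\<Sum>i\<in>?I. a i * g i) = (\<Sum>i\<in>{1..n}. a i * g i)" for g
    by (rule sum.mono_neutral_left) auto
  ultimately show ?thesis using sq by simp
qed

lemma second_moment_linear:
  assumes a: "sq_norm n a = 1"
  shows "integrable (gaussian n) (\<lambda>g. (\<Sum>i\<in>{1..n}. a i * g i)\<^sup>2)"
    and "(\<integral>g. (\<Sum>i\<in>{1..n}. a i * g i)\<^sup>2 \<partial>gaussian n) = 1"
proof -
  note d = distributed_linear[OF a]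
  show "integrable (gaussian n) (\<lambda>g. (\<Sum>i\<in>{1..n}. a i * g i)\<^sup>2)"
    using distributed_integrable[OF d, of "\<lambda>x. x\<^sup>2"] std_normal_moment_even[of 1]
    by (auto simp: has_bochner_integral_iff)
  show "(\<integral>g. (\<Sum>i\<in>{1..n}. a i * g i)\<^sup>2 \<partial>gaussian n) = 1"
    using distributed_integral[OF d, of "\<lambda>x. x\<^sup>2"] std_normal_moment_even[of 1]
    by (auto simp: has_bochner_integral_iff fact_numeral)
qed

text \<open>The factor \<open>exp (- (t * x\<^sup>2))\<close> shrinks the variance from 1 to
  \<open>1 / (1 + 2 * t)\<close>; what remains is the ratio of the normalising constants.\<close>

lemma std_normal_exp_sq:
  fixes t :: real assumes "0 \<le> t"
  shows "std_normal_density x * exp (- (t * x\<^sup>2)) = normal_density 0 (1 / sqrt (1 + 2 * t)) x / sqrt (1 + 2 * t)"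
proof -
  have *: "exp (- (x\<^sup>2 / 2)) * exp (- (t * x\<^sup>2)) = exp (- (x\<^sup>2 * (1 + 2 * t) / 2))"
    by (simp add: field_simps flip: exp_add)
  show ?thesis
    using assms * unfolding normal_density_def
    by (simp add: real_sqrt_divide real_sqrt_mult field_simps)
qed

text \<open>Laplace transform of a chi-squared variable with one degree of freedom.\<close>

lemma exp_moment_linear:
  assumes a: "sq_norm n a = 1" and t: "0 \<le> (t::real)"
  shows "integrable (gaussian n) (\<lambda>g. exp (- (t * (\<Sum>i\<in>{1..n}. a i * g i)\<^sup>2)))"
    and "(\<integral>g. exp (- (t * (\<Sum>i\<in>{1..n}. a i * g i)\<^sup>2)) \<partial>gaussian n) = 1 / sqrt (1 + 2 * t)"
proof -
  note d = distributed_linear[OF a]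
  show "integrable (gaussian n) (\<lambda>g. exp (- (t * (\<Sum>i\<in>{1..n}. a i * g i)\<^sup>2)))"
    using distributed_integrable[OF d, of "\<lambda>x. exp (- (t * x\<^sup>2))"] t
    by (simp add: std_normal_exp_sq)
  show "(\<integral>g. exp (- (t * (\<Sum>i\<in>{1..n}. a i * g i)\<^sup>2)) \<partial>gaussian n) = 1 / sqrt (1 + 2 * t)"
    using distributed_integral[OF d, of "\<lambda>x. exp (- (t * x\<^sup>2))"] t
    by (simp add: std_normal_exp_sq)
qed

text \<open>An exponential moment bound for the lower tail. The form is a convex combination of
  squared standard normals with weights \<open>w v * N v\<close>, so convexity of exp bounds its
  exponential by the average \<open>R\<close>, whose expectation is computed term by term.
  Correlations between the columns thus never enter.\<close>

lemma quadratic_form_small_ball: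
  fixes t :: real
  assumes V: "finite V" and w: "\<And>v. v \<in> V \<Longrightarrow> 0 \<le> w v" and t: "0 < t"
    and norm: "(\<Sum>v\<in>V. w v * sq_norm n (\<lambda>i. X i v)) = 1"
  shows "measure (gaussian n) {g \<in> space (gaussian n). t * (\<Sum>v\<in>V. w v * (rounding n X g v)\<^sup>2) \<le> 1}
    \<le> exp 1 / sqrt (1 + 2 * t)"
proof -
  interpret prob_space "gaussian n" by (rule prob_space_gaussian)
  have n: "1 \<le> n"
    using norm by (cases n) (auto simp: sq_norm_def)
  define N where "N v = sq_norm n (\<lambda>i. X i v)" for v
  \<comment> \<open>A zero column receives the first unit vector as its direction, so that every
    \<open>z v\<close> is standard normal; its weight \<open>N v\<close> is 0 anyway.\<close>
  define u where "u v i = (if N v = 0 then (if i = 1 then 1 else 0) else X i v / sqrt (N v))" for v i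
  define z where "z v g = (\<Sum>i\<in>{1..n}. u v i * g i)" for v and g :: "nat \<Rightarrow> real"
  define R where "R g = (\<Sum>v\<in>V. w v * N v * exp (- (t * (z v g)\<^sup>2)))" for g
  have N: "0 \<le> N v" for v by (simp add: N_def sq_norm_def sum_nonneg)
  have unit: "sq_norm n (u v) = 1" for v
  proof (cases "N v = 0")
    case True
    have "(u v i)\<^sup>2 = (if i = 1 then 1 else 0)" for i using True by (simp add: u_def)
    then show ?thesis using n by (simp add: sq_norm_def)
  next
    case False
    then show ?thesis
      using N[of v] by (simp add: sq_norm_def u_def power_divide flip: sum_divide_distrib)
        (simp add: N_def sq_norm_def)
  qed
  have sq: "(rounding n X g v)\<^sup>2 = N v * (z v g)\<^sup>2" for g v
  proof (cases "N v = 0")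
    case True
    then have "\<forall>i\<in>{1..n}. X i v = 0" by (simp add: N_def sq_norm_def sum_nonneg_eq_0_iff)
    then have "rounding n X g v = 0" by (simp add: rounding_def)
    then show ?thesis using True by simp
  next
    case False
    then have "z v g = rounding n X g v / sqrt (N v)"
      by (simp add: z_def u_def rounding_def sum_divide_distrib)
    then show ?thesis using False N[of v] by (simp add: power_divide)
  qed
  have Rint: "integrable (gaussian n) R"
    unfolding R_def z_def
    by (intro Bochner_Integration.integrable_sum integrable_mult_right exp_moment_linear unit) (use t in auto)
  have "integral\<^sup>L (gaussian n) R = (\<Sum>v\<in>V. w v * N v * (1 / sqrt (1 + 2 * t)))"
    unfolding R_def z_def using exp_moment_linear[OF unit] t
    by (subst Bochner_Integration.integral_sum) (auto intro!: sum.cong)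
  also have "\<dots> = 1 / sqrt (1 + 2 * t)"
    using norm by (simp add: N_def flip: sum_divide_distrib)
  finally have ER: "integral\<^sup>L (gaussian n) R = 1 / sqrt (1 + 2 * t)" .
  have jensen: "exp (- (t * (\<Sum>v\<in>V. w v * (rounding n X g v)\<^sup>2))) \<le> R g" for g
  proof -
    have "V \<noteq> {}" using norm by auto
    \<comment> \<open>Jensen's inequality; the weights sum to 1 by \<open>norm\<close>.\<close>
    then have "exp (\<Sum>v\<in>V. (w v * N v) *\<^sub>R - (t * (z v g)\<^sup>2)) \<le> R g"
      unfolding R_def using norm w N V
      by (intro convex_on_sum[OF _ _ exp_convex]) (auto simp: N_def)
    then show ?thesis
      by (simp add: sq sum_negf sum_distrib_left mult_ac)
  qed
  have "measure (gaussian n) {g \<in> space (gaussian n). t * (\<Sum>v\<in>V. w v * (rounding n X g v)\<^sup>2) \<le> 1}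
      \<le> measure (gaussian n) {g \<in> space (gaussian n). R g \<ge> exp (- 1)}"
  proof (rule finite_measure_mono)
    show "{g \<in> space (gaussian n). t * (\<Sum>v\<in>V. w v * (rounding n X g v)\<^sup>2) \<le> 1}
        \<subseteq> {g \<in> space (gaussian n). R g \<ge> exp (- 1)}"
    proof safe
      fix g assume "t * (\<Sum>v\<in>V. w v * (rounding n X g v)\<^sup>2) \<le> 1"
      then have "exp (- 1) \<le> exp (- (t * (\<Sum>v\<in>V. w v * (rounding n X g v)\<^sup>2)))" by simp
      also note jensen
      finally show "exp (- 1) \<le> R g" .
    qed
    show "{g \<in> space (gaussian n). R g \<ge> exp (- 1)} \<in> sets (gaussian n)"
      using borel_measurable_integrable[OF Rint] by measurable
  qed
  \<comment> \<open>Markov's inequality at level \<open>exp (- 1)\<close> accounts for the factor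
    \<open>exp 1\<close>.\<close>
  also have "\<dots> \<le> integral\<^sup>L (gaussian n) R / exp (- 1)"
    using w N by (intro integral_Markov_inequality_measure[OF Rint sets.empty_sets])
      (auto simp: R_def intro!: sum_nonneg)
  finally show ?thesis by (simp add: ER exp_minus field_simps)
qed

text \<open>The strict inequality in the event keeps the bound true for \<open>B = 0\<close>, where
  \<open>W\<close> vanishes almost everywhere. This happens in the application when the Cheeger
  constant is 0.\<close>

lemma (in prob_space) Markov_inequality_scaled:
  fixes W :: "'a \<Rightarrow> real"
  assumes W: "integrable M W" "\<And>x. 0 \<le> W x" and B: "integral\<^sup>L M W \<le> B" and a: "0 < a"
  shows "measure M {x \<in> space M. a * B < W x} \<le> 1 / a"
proof (cases "B = 0")
  case True
  moreover have "0 \<le> integral\<^sup>L M W" using W(2) by simp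
  ultimately have "integral\<^sup>L M W = 0" using B by linarith
  then have "AE x in M. W x = 0"
    using integral_nonneg_eq_0_iff_AE[OF W(1)] W(2) by simp
  then have "AE x in M. x \<notin> {x \<in> space M. a * B < W x}"
    using True by auto
  then have "measure M {x \<in> space M. a * B < W x} = 0"
    using borel_measurable_integrable[OF W(1)] by (subst measure_eq_0_null_sets) (auto intro!: AE_iff_null_sets[THEN iffD2])
  then show ?thesis using a by simp
next
  case False
  moreover have "0 \<le> integral\<^sup>L M W" using W(2) by simp
  ultimately have "0 < B" using B by linarith
  have "measure M {x \<in> space M. a * B < W x} \<le> measure M {x \<in> space M. a * B \<le> W x}"
    using borel_measurable_integrable[OF W(1)] by (intro finite_measure_mono) auto
  also have "\<dots> \<le> integral\<^sup>L M W / (a * B)"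
    using W a \<open>0 < B\<close> by (intro integral_Markov_inequality_measure[OF _ sets.empty_sets]) auto
  also have "\<dots> \<le> B / (a * B)"
    using B a \<open>0 < B\<close> by (intro divide_right_mono) auto
  finally show ?thesis using \<open>0 < B\<close> by simp
qed

section \<open>Projections\<close>

definition ip :: "nat \<Rightarrow> (nat \<Rightarrow> real) \<Rightarrow> (nat \<Rightarrow> real) \<Rightarrow> real" where
  "ip n a b = (\<Sum>i\<in>{1..n}. a i * b i)"

lemma ip_commute: "ip n a b = ip n b a"
  by (simp add: ip_def mult.commute)

lemma ip_self: "ip n a a = sq_norm n a"
  by (simp add: ip_def sq_norm_def power2_eq_square)

lemma ip_cong: "(\<And>i. i \<in> {1..n} \<Longrightarrow> a i = a' i) \<Longrightarrow> ip n a b = ip n a' b"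
  by (simp add: ip_def)

lemma ip_sum_left: "ip n (\<lambda>i. \<Sum>j\<in>J. c j * u j i) b = (\<Sum>j\<in>J. c j * ip n (u j) b)"
  by (simp add: ip_def sum_distrib_left sum_distrib_right mult.assoc) (rule sum.swap)

lemma ip_diff_left: "ip n (\<lambda>i. a i - a' i) b = ip n a b - ip n a' b"
  by (simp add: ip_def left_diff_distrib sum_subtractf)

lemma ip_divide_right: "ip n a (\<lambda>i. b i / c) = ip n a b / c"
  by (simp add: ip_def sum_divide_distrib)

text \<open>Gram-Schmidt, one vector of the family at a time. Expansions are asserted on
  \<open>{1..n}\<close> only, since the values of a vector elsewhere are arbitrary.\<close>

lemma orthonormal_basis_exists:
  fixes x :: "'a \<Rightarrow> nat \<Rightarrow> real"
  assumes "finite A"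
  shows "\<exists>U k. k \<le> card A \<and> (\<forall>j<k. \<forall>l<k. ip n (U j) (U l) = of_bool (j = l))
    \<and> (\<forall>v\<in>A. \<forall>i\<in>{1..n}. x v i = (\<Sum>j<k. ip n (x v) (U j) * U j i))"
  using assms
proof (induction A)
  case empty
  show ?case by (intro exI[of _ "\<lambda>_ _. 0"] exI[of _ 0]) simp
next
  case (insert v A)
  then obtain U k where k: "k \<le> card A"
    and orth: "\<And>j l. \<lbrakk>j < k; l < k\<rbrakk> \<Longrightarrow> ip n (U j) (U l) = of_bool (j = l)"
    and span: "\<And>w i. \<lbrakk>w \<in> A; i \<in> {1..n}\<rbrakk> \<Longrightarrow> x w i = (\<Sum>j<k. ip n (x w) (U j) * U j i)"
    by blast
  \<comment> \<open>The residual of the new vector after projection to the span found so far; if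
    nonzero it is normalised and appended as \<open>U k\<close>.\<close>
  define r where "r i = x v i - (\<Sum>j<k. ip n (x v) (U j) * U j i)" for i
  have ip_r: "ip n r b = ip n (x v) b - (\<Sum>j<k. ip n (x v) (U j) * ip n (U j) b)" for b
    by (simp add: r_def[abs_def] ip_diff_left ip_sum_left)
  have r_orth: "ip n (U l) r = 0" if "l < k" for l
  proof -
    have "(\<Sum>j<k. ip n (x v) (U j) * ip n (U j) (U l)) = (\<Sum>j<k. if j = l then ip n (x v) (U j) else 0)"
      using that by (intro sum.cong) (auto simp: orth)
    also have "\<dots> = ip n (x v) (U l)" using that by simp
    finally show ?thesis using ip_r[of "U l"] by (simp add: ip_commute)
  qed
  have v_eq: "x v i = r i + (\<Sum>j<k. ip n (x v) (U j) * U j i)" for i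
    by (simp add: r_def)
  show ?case
  proof (cases "sq_norm n r = 0")
    case True
    then have "\<And>i. i \<in> {1..n} \<Longrightarrow> r i = 0"
      by (simp add: sq_norm_def sum_nonneg_eq_0_iff)
    then have "x w i = (\<Sum>j<k. ip n (x w) (U j) * U j i)" if "w \<in> insert v A" "i \<in> {1..n}" for w i
      using that span[of w i] v_eq[of i] by auto
    then show ?thesis
      using k orth insert.hyps by (intro exI[of _ U] exI[of _ k]) simp
  next
    case False
    then have pos: "0 < sq_norm n r"
      by (simp add: sq_norm_def sum_nonneg less_le)
    define u where "u i = r i / sqrt (sq_norm n r)" for i
    define U' where "U' = U(k := u)"
    have ip_u: "ip n b u = ip n b r / sqrt (sq_norm n r)" for b
      by (simp add: u_def[abs_def] ip_divide_right)
    have uu: "ip n u u = 1"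
      using ip_u[of u] ip_u[of r] pos by (simp add: ip_commute[of n u r] ip_self)
    have Uu: "ip n (U l) u = 0" if "l < k" for l
      using r_orth[OF that] by (simp add: ip_u)
    have orth': "ip n (U' j) (U' l) = of_bool (j = l)" if "j < Suc k" "l < Suc k" for j l
    proof (cases "j = k")
      case True
      then show ?thesis
        using that uu Uu[of l] by (auto simp: U'_def ip_commute[of n u "U l"])
    next
      case False
      then show ?thesis
        using that orth[of j l] Uu[of j] by (auto simp: U'_def)
    qed
    have sum_U': "(\<Sum>j<Suc k. ip n a (U' j) * U' j i) = (\<Sum>j<k. ip n a (U j) * U j i) + ip n a u * u i" for a i
      by (simp add: U'_def)
    have "x w i = (\<Sum>j<Suc k. ip n (x w) (U' j) * U' j i)" if w: "w \<in> insert v A" and i: "i \<in> {1..n}" for w i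
    proof (cases "w = v")
      case True
      have "ip n (x v) r = sq_norm n r" using ip_r[of r] by (simp add: r_orth ip_self)
      then have "ip n (x v) u * u i = r i"
        using pos by (simp add: ip_u) (simp add: u_def)
      then show ?thesis using v_eq[of i] True by (simp add: sum_U' del: sum.lessThan_Suc)
    next
      case False
      then have "w \<in> A" using w by simp
      then have "ip n (x w) u = ip n (\<lambda>i. \<Sum>j<k. ip n (x w) (U j) * U j i) u"
        by (intro ip_cong span)
      also have "\<dots> = 0" by (simp add: ip_sum_left Uu)
      finally show ?thesis
        using span[OF \<open>w \<in> A\<close> i] by (simp add: sum_U' del: sum.lessThan_Suc)
    qed
    then show ?thesis
      using k orth' insert.hyps
      by (intro exI[of _ U'] exI[of _ "Suc k"]) (simp del: sum.lessThan_Suc)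
  qed
qed

text \<open>
  The vectors \<open>X y\<close> with \<open>y\<close> supported on \<open>e\<close> span a space of dimension at most \<open>card e\<close>, so only
  the projection of \<open>g\<close> to that space matters, whose squared norm is the sum on the right.
\<close>

lemma projection_bound:
  fixes X :: "nat \<Rightarrow> 'a \<Rightarrow> real"
  assumes "finite e"
  shows "\<exists>U k. k \<le> card e \<and> (\<forall>j<k. sq_norm n (U j) = 1)
    \<and> (\<forall>y g. (\<Sum>i\<in>{1..n}. (\<Sum>v\<in>e. X i v * y v) * g i)\<^sup>2
      \<le> sq_norm n (\<lambda>i. \<Sum>v\<in>e. X i v * y v) * (\<Sum>j<k. (\<Sum>i\<in>{1..n}. U j i * g i)\<^sup>2))"
proof -
  obtain U k where k: "k \<le> card e"
    and orth: "\<And>j l. \<lbrakk>j < k; l < k\<rbrakk> \<Longrightarrow> ip n (U j) (U l) = of_bool (j = l)"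
    and span: "\<And>v i. \<lbrakk>v \<in> e; i \<in> {1..n}\<rbrakk> \<Longrightarrow> X i v = (\<Sum>j<k. ip n (\<lambda>i. X i v) (U j) * U j i)"
    using orthonormal_basis_exists[OF assms, of n "\<lambda>v i. X i v"] by blast
  show ?thesis
  proof (intro exI[of _ U] exI[of _ k] conjI allI impI k)
    show "sq_norm n (U j) = 1" if "j < k" for j
      using orth[OF that that] by (simp add: ip_self)
    fix y :: "'a \<Rightarrow> real" and g :: "nat \<Rightarrow> real"
    define z where "z i = (\<Sum>v\<in>e. X i v * y v)" for i
    have zU: "ip n z b = (\<Sum>v\<in>e. y v * ip n (\<lambda>i. X i v) b)" for b
      using ip_sum_left[of n y "\<lambda>v i. X i v" e b] by (simp add: z_def[abs_def] mult.commute)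
    have z: "z i = (\<Sum>j<k. ip n z (U j) * U j i)" if i: "i \<in> {1..n}" for i
    proof -
      have "z i = (\<Sum>v\<in>e. (\<Sum>j<k. ip n (\<lambda>i. X i v) (U j) * U j i) * y v)"
        unfolding z_def by (intro sum.cong refl) (use span i in simp)
      also have "\<dots> = (\<Sum>j<k. ip n z (U j) * U j i)"
        unfolding zU sum_distrib_right by (subst sum.swap) (simp add: mult_ac)
      finally show ?thesis .
    qed
    have expand: "ip n z b = (\<Sum>j<k. ip n z (U j) * ip n (U j) b)" for b
      using ip_cong[of n z "\<lambda>i. \<Sum>j<k. ip n z (U j) * U j i" b] z by (simp add: ip_sum_left)
    \<comment> \<open>Cauchy-Schwarz for the coordinates of \<open>z\<close> and \<open>g\<close>
      with respect to \<open>U\<close>, followed by Parseval's identity for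
      \<open>z\<close>.\<close>
    have "(ip n z g)\<^sup>2 \<le> (\<Sum>j<k. (ip n z (U j))\<^sup>2) * (\<Sum>j<k. (ip n (U j) g)\<^sup>2)"
      unfolding expand[of g] by (rule Cauchy_Schwarz_ineq_sum)
    also have "(\<Sum>j<k. (ip n z (U j))\<^sup>2) = sq_norm n z"
      using expand[of z] by (simp add: power2_eq_square ip_commute[of n _ z] ip_self)
    finally show "(\<Sum>i\<in>{1..n}. (\<Sum>v\<in>e. X i v * y v) * g i)\<^sup>2
      \<le> sq_norm n (\<lambda>i. \<Sum>v\<in>e. X i v * y v) * (\<Sum>j<k. (\<Sum>i\<in>{1..n}. U j i * g i)\<^sup>2)"
      by (simp add: ip_def z_def[abs_def])
  qed
qed

section \<open>Greedy extreme points and threshold sets\<close>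

lemma summation_by_parts:
  fixes f p :: "nat \<Rightarrow> real"
  shows "(\<Sum>i<Suc m. (f (Suc i) - f i) * p i)
    = f (Suc m) * p m - f 0 * p 0 + (\<Sum>i<m. f (Suc i) * (p i - p (Suc i)))"
  by (induction m) (simp_all add: algebra_simps)

lemma obtain_decreasing_enumeration:
  fixes x :: "'a::linorder \<Rightarrow> real"
  assumes "finite A"
  obtains s where "bij_betw s {..<card A} A"
    and "\<And>i j. \<lbrakk>i \<le> j; j < card A\<rbrakk> \<Longrightarrow> x (s j) \<le> x (s i)"
proof -
  define l where "l = sort_key (\<lambda>v. - x v) (sorted_list_of_set A)"
  have l: "distinct l" "set l = A" "length l = card A" "sorted (map (\<lambda>v. - x v) l)"
    using assms by (auto simp: l_def)
  show thesis
  proof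
    show "bij_betw ((!) l) {..<card A} A"
      using l by (intro bij_betw_nth) auto
    show "x (l ! j) \<le> x (l ! i)" if "i \<le> j" "j < card A" for i j
      using sorted_nth_mono[OF l(4), of i j] that l(3) by simp
  qed
qed

lemma signed_square_mono:
  fixes a b :: real
  assumes "a \<le> b"
  shows "a * \<bar>a\<bar> \<le> b * \<bar>b\<bar>"
proof -
  consider "0 \<le> a" | "a \<le> 0" "0 \<le> b" | "b \<le> 0"
    by linarith
  then show ?thesis
  proof cases
    case 1
    then show ?thesis using assms by (simp add: mult_mono)
  next
    case 2
    then have "a * \<bar>a\<bar> \<le> 0" "0 \<le> b * \<bar>b\<bar>" by (simp_all add: mult_le_0_iff)
    then show ?thesis by linarith
  next
    case 3
    then have "b * b \<le> a * a"
      using assms mult_mono[of "-b" "-a" "-b" "-a"] by simp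
    then show ?thesis using 3 assms by simp
  qed
qed

text \<open>The derivative of \<open>t * \<bar>t\<bar>\<close> is \<open>2 * \<bar>t\<bar>\<close>,
  which is at most \<open>2 * M\<close> on the interval from \<open>- M\<close> to
  \<open>M\<close>.\<close>

lemma signed_square_lipschitz:
  fixes a b :: real
  assumes "a \<le> b" "\<bar>a\<bar> \<le> M" "\<bar>b\<bar> \<le> M"
  shows "b * \<bar>b\<bar> - a * \<bar>a\<bar> \<le> 2 * M * (b - a)"
proof -
  consider "0 \<le> a" | "a \<le> 0" "0 \<le> b" | "b \<le> 0"
    by linarith
  then show ?thesis
  proof cases
    case 1
    have "(b + a) * (b - a) \<le> (2 * M) * (b - a)"
      using assms by (intro mult_right_mono) auto
    then show ?thesis using 1 assms by (simp add: algebra_simps)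
  next
    case 2
    have "b * b \<le> M * b" "(- a) * (- a) \<le> M * (- a)" "0 \<le> M * b" "0 \<le> M * (- a)"
      using 2 assms by (intro mult_right_mono mult_nonneg_nonneg; simp)+
    then show ?thesis using 2 by (simp add: algebra_simps)
  next
    case 3
    have "(- (b + a)) * (b - a) \<le> (2 * M) * (b - a)"
      using assms by (intro mult_right_mono) auto
    then show ?thesis using 3 assms by (simp add: algebra_simps)
  qed
qed

text \<open>Edmonds' greedy vector for the order \<open>s\<close>: the entry at a vertex is the
  marginal cut value when it joins its predecessors. \<open>the_inv_into\<close> recovers the
  position of the vertex.\<close>

definition greedy :: "hypergraph \<Rightarrow> (nat \<Rightarrow> nat) \<Rightarrow> nat set \<Rightarrow> nat \<Rightarrow> real" where
  "greedy G s e v = (if v \<in> verts G then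
      let i = the_inv_into {..<num_verts G} s v
      in cut G e (s ` {..<Suc i} \<inter> e) - cut G e (s ` {..<i} \<inter> e) else 0)"

section \<open>Elementary facts on cuts, volumes and the base polytope\<close>

context submodular_hypergraph
begin

lemma finite_verts [simp]: "finite (verts G)"
  by (simp add: verts_def)

lemma card_verts [simp]: "card (verts G) = num_verts G"
  by (simp add: verts_def)

lemma finite_edges [simp]: "finite (edges G)"
  using edges_subset by (rule finite_subset) simp

lemma edge_subset: "e \<in> edges G \<Longrightarrow> e \<subseteq> verts G"
  using edges_subset by auto

lemma finite_edge: "e \<in> edges G \<Longrightarrow> finite e"
  by (rule finite_subset[OF edge_subset]) auto

lemma cut_nonneg: "e \<in> edges G \<Longrightarrow> 0 \<le> cut G e (S \<inter> e)"
  using cut_range[of e "S \<inter> e"] by auto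

lemma cut_le_one: "e \<in> edges G \<Longrightarrow> cut G e (S \<inter> e) \<le> 1"
  using cut_range[of e "S \<inter> e"] by auto

lemma cut_union_inter:
  assumes "e \<in> edges G"
  shows "cut G e ((S \<union> T) \<inter> e) + cut G e (S \<inter> T \<inter> e) \<le> cut G e (S \<inter> e) + cut G e (T \<inter> e)"
proof -
  have "(S \<union> T) \<inter> e = (S \<inter> e) \<union> (T \<inter> e)" "S \<inter> T \<inter> e = (S \<inter> e) \<inter> (T \<inter> e)"
    by auto
  then show ?thesis
    using cut_submodular[OF assms, of "S \<inter> e" "T \<inter> e"] by simp
qed

lemma cut_complement:
  assumes "e \<in> edges G"
  shows "cut G e ((verts G - S) \<inter> e) = cut G e (S \<inter> e)"
proof -
  have "(verts G - S) \<inter> e = e - S \<inter> e"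
    using edge_subset[OF assms] by auto
  then show ?thesis
    using cut_symmetric[OF assms, of "S \<inter> e"] by simp
qed

lemma cut_verts: "e \<in> edges G \<Longrightarrow> cut G e (verts G \<inter> e) = 0"
  using cut_complement[of e "{}"] cut_empty[of e] by simp

lemma vol_complement: "S \<subseteq> verts G \<Longrightarrow> vol G (verts G - S) = vol G (verts G) - vol G S"
  unfolding vol_def by (simp add: sum_diff)

lemma vol_nonneg: "S \<subseteq> verts G \<Longrightarrow> 0 \<le> vol G S"
  unfolding vol_def by (intro sum_nonneg) (use mu_pos in \<open>force intro: less_imp_le\<close>)

lemma vol_pos: "\<lbrakk>S \<subseteq> verts G; S \<noteq> {}\<rbrakk> \<Longrightarrow> 0 < vol G S"
  unfolding vol_def by (intro sum_pos) (use mu_pos finite_subset[OF _ finite_verts] in auto)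

lemma vol_boundary_nonneg: "0 \<le> vol_boundary G S"
  unfolding vol_boundary_def
  by (intro sum_nonneg mult_nonneg_nonneg) (use scale_pos cut_nonneg in \<open>auto intro: less_imp_le\<close>)

lemma conductance_nonneg: "S \<subseteq> verts G \<Longrightarrow> 0 \<le> conductance G S"
  unfolding conductance_def
  by (intro divide_nonneg_nonneg) (auto simp: vol_boundary_nonneg intro!: vol_nonneg)

lemma tau_upper:
  assumes "v \<in> verts G"
  shows "degree G v \<le> tau G * mu G v"
proof -
  have "degree G v / mu G v \<le> tau G"
    unfolding tau_def using assms by (intro Max_ge) auto
  then show ?thesis using mu_pos[OF assms] by (simp add: field_simps)
qed

lemma zeta_upper: "e \<in> edges G \<Longrightarrow> card e \<le> zeta G"
  unfolding zeta_def by (intro Max_ge) auto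

text \<open>For \<open>v\<close> outside \<open>e\<close> the constraint of \<open>{v}\<close> gives
  \<open>y v \<le> 0\<close>. The constraint of the complement, together with total sum 0 and
  symmetry of the cut, gives \<open>- y v \<le> 0\<close>.\<close>

lemma base_polytope_vanishes:
  assumes e: "e \<in> edges G" and y: "y \<in> base_polytope G e" and v: "v \<notin> e"
  shows "y v = 0"
proof (cases "v \<in> verts G")
  case True
  have le: "(\<Sum>v\<in>S. y v) \<le> cut G e (S \<inter> e)" if "S \<subseteq> verts G" for S
    using y that by (auto simp: base_polytope_def)
  have "y v \<le> cut G e ({v} \<inter> e)"
    using le[of "{v}"] True by simp
  moreover have "(\<Sum>u\<in>verts G - {v}. y u) \<le> cut G e ((verts G - {v}) \<inter> e)"
    by (rule le) auto
  moreover have "(\<Sum>u\<in>verts G - {v}. y u) = - y v"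
    using True y by (simp add: sum_diff1 base_polytope_def)
  ultimately show ?thesis
    using v cut_complement[OF e, of "{v}"] cut_empty[OF e] by simp
qed (use y in \<open>auto simp: base_polytope_def\<close>)

section \<open>Greedy vectors for a fixed enumeration of the vertices\<close>

context
  fixes s :: "nat \<Rightarrow> nat"
  assumes s: "bij_betw s {..<num_verts G} (verts G)"
begin

lemma prefix_subset: "k \<le> num_verts G \<Longrightarrow> s ` {..<k} \<subseteq> verts G"
  using s by (auto simp: bij_betw_def)

lemma enum_in_verts: "i < num_verts G \<Longrightarrow> s i \<in> verts G"
  using s by (auto simp: bij_betw_def)

lemma enum_notin_prefix: "i < num_verts G \<Longrightarrow> s i \<notin> s ` {..<i}"
  using s by (force simp: bij_betw_def dest: inj_onD)

lemma prefix_all: "s ` {..<num_verts G} = verts G"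
  using s by (simp add: bij_betw_def)

lemma sum_enum: "(\<Sum>v\<in>verts G. f v) = (\<Sum>i<num_verts G. f (s i))"
  by (rule sum.reindex_bij_betw[OF s, symmetric])

lemma greedy_enum:
  "i < num_verts G \<Longrightarrow>
    greedy G s e (s i) = cut G e (s ` {..<Suc i} \<inter> e) - cut G e (s ` {..<i} \<inter> e)"
  using s enum_in_verts by (simp add: greedy_def bij_betw_def the_inv_into_f_f)

lemma sum_prefix_Suc:
  fixes f :: "nat \<Rightarrow> real"
  assumes "i < num_verts G"
  shows "(\<Sum>v\<in>s ` {..<Suc i}. f v) = (\<Sum>v\<in>s ` {..<i}. f v) + f (s i)"
  using enum_notin_prefix[OF assms] by (simp add: lessThan_Suc)

lemma greedy_prefix:
  assumes e: "e \<in> edges G"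
  shows "k \<le> num_verts G \<Longrightarrow> (\<Sum>v\<in>s ` {..<k}. greedy G s e v) = cut G e (s ` {..<k} \<inter> e)"
proof (induction k)
  case 0
  show ?case using cut_empty[OF e] by simp
next
  case (Suc k)
  then show ?case by (subst sum_prefix_Suc) (simp_all add: greedy_enum)
qed

text \<open>Submodularity as diminishing returns: adding \<open>s k\<close> to the whole prefix
  gains at most as much as adding it to the part of the prefix inside \<open>T\<close>.\<close>

lemma greedy_sum_le:
  assumes e: "e \<in> edges G"
  shows "k \<le> num_verts G \<Longrightarrow>
    (\<Sum>v\<in>T \<inter> s ` {..<k}. greedy G s e v) \<le> cut G e (T \<inter> s ` {..<k} \<inter> e)"
proof (induction k)
  case 0
  show ?case using cut_empty[OF e] by simp
next
  case (Suc k)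
  show ?case
  proof (cases "s k \<in> T")
    case True
    have eq: "T \<inter> s ` {..<Suc k} = insert (s k) (T \<inter> s ` {..<k})"
      using True by (auto simp: lessThan_Suc)
    have "(\<Sum>v\<in>T \<inter> s ` {..<Suc k}. greedy G s e v)
        = greedy G s e (s k) + (\<Sum>v\<in>T \<inter> s ` {..<k}. greedy G s e v)"
      unfolding eq using enum_notin_prefix[of k] Suc.prems by (subst sum.insert) auto
    also have "\<dots> \<le> cut G e (s ` {..<Suc k} \<inter> e) - cut G e (s ` {..<k} \<inter> e)
        + cut G e (T \<inter> s ` {..<k} \<inter> e)"
      using Suc by (simp add: greedy_enum)
    also have "\<dots> \<le> cut G e (T \<inter> s ` {..<Suc k} \<inter> e)"
    proof -
      have "T \<inter> s ` {..<Suc k} \<union> s ` {..<k} = s ` {..<Suc k}"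
        "T \<inter> s ` {..<Suc k} \<inter> s ` {..<k} = T \<inter> s ` {..<k}"
        using True by (auto simp: lessThan_Suc)
      then show ?thesis
        using cut_union_inter[OF e, of "T \<inter> s ` {..<Suc k}" "s ` {..<k}"] by simp
    qed
    finally show ?thesis .
  next
    case False
    then have "T \<inter> s ` {..<Suc k} = T \<inter> s ` {..<k}"
      by (auto simp: lessThan_Suc)
    then show ?thesis using Suc by simp
  qed
qed

lemma greedy_in_base_polytope:
  assumes e: "e \<in> edges G"
  shows "greedy G s e \<in> base_polytope G e"
proof -
  have "(\<Sum>v\<in>S. greedy G s e v) \<le> cut G e (S \<inter> e)" if "S \<subseteq> verts G" for S
    using greedy_sum_le[OF e order_refl, of S] that by (simp add: prefix_all Int_absorb2)
  moreover have "(\<Sum>v\<in>verts G. greedy G s e v) = 0"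
    using greedy_prefix[OF e order_refl] by (simp add: prefix_all cut_verts[OF e])
  ultimately show ?thesis
    by (auto simp: base_polytope_def greedy_def)
qed

text \<open>The greedy vector saturates the constraints of all the prefixes, and these determine it.\<close>

lemma greedy_extreme:
  assumes e: "e \<in> edges G"
  shows "greedy G s e \<in> extreme_points (base_polytope G e)"
proof -
  have "a = b" if ab: "a \<in> base_polytope G e" "b \<in> base_polytope G e"
    and u: "0 < u" "u < 1" and y: "greedy G s e = (\<lambda>v. (1 - u) * a v + u * b v)" for a b u
  proof -
    have tight: "(\<Sum>v\<in>s ` {..<k}. a v) = (\<Sum>v\<in>s ` {..<k}. b v)" if k: "k \<le> num_verts G" for k
    proof -
      let ?c = "cut G e (s ` {..<k} \<inter> e)"
      let ?a = "\<Sum>v\<in>s ` {..<k}. a v" and ?b = "\<Sum>v\<in>s ` {..<k}. b v"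
      have le: "?a \<le> ?c" "?b \<le> ?c"
        using ab prefix_subset[OF k] by (auto simp: base_polytope_def)
      have "(1 - u) * ?a + u * ?b = ?c"
        using greedy_prefix[OF e k] by (simp add: y sum.distrib sum_distrib_left)
      then have sum0: "(1 - u) * (?c - ?a) + u * (?c - ?b) = 0"
        by (simp add: algebra_simps)
      \<comment> \<open>Two nonnegative slacks with vanishing sum are both zero, so \<open>a\<close>
        and \<open>b\<close> attain equality on the prefix too.\<close>
      have "0 \<le> (1 - u) * (?c - ?a)" "0 \<le> u * (?c - ?b)"
        using u le by auto
      with sum0 have "(1 - u) * (?c - ?a) = 0" "u * (?c - ?b) = 0"
        by linarith+
      then show ?thesis using u by simp
    qed
    show "a = b"
    proof
      fix v
      show "a v = b v"
      proof (cases "v \<in> verts G")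
        case True
        then obtain i where i: "i < num_verts G" "v = s i"
          using prefix_all by auto
        show ?thesis
          using tight[of i] tight[of "Suc i"] i by (simp add: sum_prefix_Suc)
      qed (use ab in \<open>simp add: base_polytope_def\<close>)
    qed
  qed
  then show ?thesis
    using greedy_in_base_polytope[OF e] by (auto simp: extreme_points_def)
qed

text \<open>The boundary terms vanish because the cut is 0 on the empty set and on the whole vertex
  set. For \<open>q\<close> decreasing along \<open>s\<close> the value is the Lovasz extension of
  the cut function at \<open>q\<close>.\<close>

lemma greedy_by_parts:
  assumes e: "e \<in> edges G"
  shows "(\<Sum>v\<in>verts G. greedy G s e v * q v)
    = (\<Sum>i<num_verts G - 1. cut G e (s ` {..<Suc i} \<inter> e) * (q (s i) - q (s (Suc i))))"
proof (cases "num_verts G")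
  case 0
  then show ?thesis by (simp add: sum_enum)
next
  case (Suc m)
  have "(\<Sum>v\<in>verts G. greedy G s e v * q v)
      = (\<Sum>i<Suc m. (cut G e (s ` {..<Suc i} \<inter> e) - cut G e (s ` {..<i} \<inter> e)) * q (s i))"
    unfolding sum_enum Suc by (intro sum.cong) (use Suc in \<open>simp_all add: greedy_enum\<close>)
  also have "\<dots> = cut G e (verts G \<inter> e) * q (s m) - cut G e {} * q (s 0)
      + (\<Sum>i<m. cut G e (s ` {..<Suc i} \<inter> e) * (q (s i) - q (s (Suc i))))"
    using summation_by_parts[where f = "\<lambda>i. cut G e (s ` {..<i} \<inter> e)" and p = "\<lambda>i. q (s i)" and m = m]
      prefix_all Suc by simp
  finally show ?thesis
    using Suc by (simp add: cut_verts[OF e] cut_empty[OF e])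
qed

text \<open>Turns a comparison of increments along \<open>s\<close> into a comparison of pairings
  with the greedy vector.\<close>

lemma greedy_monotone_nonneg:
  assumes e: "e \<in> edges G"
    and "\<And>i. Suc i < num_verts G \<Longrightarrow> q (s (Suc i)) \<le> q (s i)"
  shows "0 \<le> (\<Sum>v\<in>verts G. greedy G s e v * q v)"
  unfolding greedy_by_parts[OF e]
  by (intro sum_nonneg mult_nonneg_nonneg cut_nonneg[OF e]) (use assms in auto)

end

section \<open>A Cheeger inequality for threshold cuts\<close>

lemma threshold_conductance_le:
  assumes "\<theta> \<in> {Min (x ` verts G)..<Max (x ` verts G)}"
  shows "threshold_conductance G x \<le> conductance G (threshold_set G x \<theta>)"
  unfolding threshold_conductance_def
proof (rule cINF_lower[OF _ assms])
  show "bdd_below ((\<lambda>\<theta>. conductance G (threshold_set G x \<theta>)) ` {Min (x ` verts G)..<Max (x ` verts G)})"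
    by (rule bdd_belowI[of _ 0]) (auto simp: threshold_set_def intro!: conductance_nonneg)
qed

text \<open>Since \<open>w\<close> lies in the threshold set and \<open>u\<close> does not, both
  volumes are positive and the denominator of the conductance can be cleared.\<close>

lemma threshold_conductance_mult_le:
  assumes "u \<in> verts G" "w \<in> verts G" "x u < x w"
  defines "S \<equiv> threshold_set G x (x u)"
  shows "threshold_conductance G x * min (vol G S) (vol G (verts G - S)) \<le> vol_boundary G S"
proof -
  have "Min (x ` verts G) \<le> x u" "x w \<le> Max (x ` verts G)"
    using assms(1,2) by simp_all
  then have "threshold_conductance G x \<le> conductance G S"
    unfolding S_def using assms(3) by (intro threshold_conductance_le) simp
  moreover have "0 < vol G S" "0 < vol G (verts G - S)"
    using assms by (intro vol_pos; force simp: threshold_set_def)+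
  ultimately show ?thesis
    by (simp add: conductance_def le_divide_eq min_def split: if_splits)
qed


text \<open>
  Choosing the median \<open>m\<close> as the value at the first prefix of at least half the volume, the
  lower bound compares \<open>t \<bar>t\<bar>\<close> (for \<open>t = x v - m\<close>) with the smaller of the two volumes cut off by
  each prefix.
\<close>

lemma level_set_lower_bound:
  assumes s: "bij_betw s {..<num_verts G} (verts G)"
    and x: "\<And>i j. \<lbrakk>i \<le> j; j < num_verts G\<rbrakk> \<Longrightarrow> x (s j) \<le> x (s i)"
    and "verts G \<noteq> {}"
  obtains m where
    "threshold_conductance G x * (\<Sum>v\<in>verts G. mu G v * (x v - m)\<^sup>2)
      \<le> (\<Sum>e\<in>edges G. scale G e * (\<Sum>v\<in>verts G. greedy G s e v * ((x v - m) * \<bar>x v - m\<bar>)))"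
proof -
  note pre = prefix_subset[OF s] and verts = enum_in_verts[OF s] and all = prefix_all[OF s]
  define N where "N = num_verts G"
  define S where "S i = s ` {..<i}" for i
  have "N \<noteq> 0" using assms(3) by (auto simp: N_def verts_def)
  then obtain M where M: "N = Suc M" by (cases N) auto
  have SV: "S i \<subseteq> verts G" if "i \<le> N" for i
    using pre that by (simp add: S_def N_def)
  have SN: "S N = verts G" using all by (simp add: S_def N_def)
  have vol_Suc: "vol G (S (Suc i)) = vol G (S i) + mu G (s i)" if "i < N" for i
    using sum_prefix_Suc[OF s, of i "mu G"] that by (simp add: vol_def S_def N_def)
  define k where "k = (LEAST k. vol G (verts G) \<le> 2 * vol G (S (Suc k)))"
  have ex: "vol G (verts G) \<le> 2 * vol G (S (Suc M))"
    using SN M vol_nonneg[of "verts G"] by simp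
  have k: "vol G (verts G) \<le> 2 * vol G (S (Suc k))" "k \<le> M"
    unfolding k_def by (rule LeastI[of _ M], rule ex) (rule Least_le, rule ex)
  have small: "2 * vol G (S i) \<le> vol G (verts G)" if "i \<le> k" for i
  proof (cases i)
    case 0
    then show ?thesis using vol_nonneg[of "verts G"] by (simp add: S_def vol_def)
  next
    case (Suc j)
    then have "j < k" using that by simp
    then have "\<not> vol G (verts G) \<le> 2 * vol G (S (Suc j))"
      unfolding k_def by (rule not_less_Least)
    then show ?thesis using Suc by simp
  qed
  have vol_mono: "vol G (S i) \<le> vol G (S j)" if "i \<le> j" "j \<le> N" for i j
    unfolding vol_def using that SV[OF that(2)] finite_subset[OF SV[OF that(2)]]
    by (intro sum_mono2) (auto simp: S_def intro!: less_imp_le[OF mu_pos])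
  have large: "vol G (verts G) \<le> 2 * vol G (S i)" if "k < i" "i \<le> N" for i
    using k(1) vol_mono[of "Suc k" i] that by simp
  define m where "m = x (s k)"
  define q where "q v = (x v - m) * \<bar>x v - m\<bar>" for v
  \<comment> \<open>The smaller volume cut off by the prefix \<open>S i\<close>, with the case
    distinction at the median resolved.\<close>
  define f where "f i = (if i \<le> k then vol G (S i) else vol G (verts G - S i))" for i
  have f_min: "f i = min (vol G (S i)) (vol G (verts G - S i))" if "i \<le> N" for i
    using small[of i] large[of i] that by (auto simp: f_def vol_complement[OF SV[OF that]])
  have q_step: "q (s (Suc i)) \<le> q (s i)" if "Suc i < N" for i
    unfolding q_def using x[of i "Suc i"] that by (intro signed_square_mono) (simp add: N_def)
  \<comment> \<open>Before \<open>k\<close> the increment of \<open>f\<close> is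
    \<open>mu G (s i)\<close> and \<open>q\<close> is the square; after \<open>k\<close> both change
    sign. At \<open>i = k\<close> the increment is uncontrolled, but there \<open>q\<close> is
    0.\<close>
  have term_eq: "(f (Suc i) - f i) * q (s i) = mu G (s i) * (x (s i) - m)\<^sup>2" if "i < N" for i
  proof -
    consider "i < k" | "i = k" | "k < i" by linarith
    then show ?thesis
    proof cases
      case 1
      then have "m \<le> x (s i)"
        using x[of i k] k(2) M by (simp add: m_def N_def)
      with 1 show ?thesis
        using vol_Suc[OF that] by (simp add: f_def q_def power2_eq_square)
    next
      case 2
      then show ?thesis by (simp add: q_def m_def)
    next
      case 3
      then have "x (s i) \<le> m"
        using x[of k i] that by (simp add: m_def N_def)
      with 3 show ?thesis
        using vol_Suc[OF that] that
        by (simp add: f_def q_def power2_eq_square vol_complement[OF SV] algebra_simps)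
    qed
  qed
  have "(\<Sum>v\<in>verts G. mu G v * (x v - m)\<^sup>2) = (\<Sum>i<Suc M. (f (Suc i) - f i) * q (s i))"
    unfolding sum_enum[OF s] using term_eq M by (intro sum.cong) (simp_all add: N_def)
  also have "\<dots> = (\<Sum>i<M. f (Suc i) * (q (s i) - q (s (Suc i))))"
  proof -
    \<comment> \<open>No boundary terms: the empty prefix has volume 0, and since
      \<open>k \<le> M\<close> the full prefix falls under the complement branch.\<close>
    have "f 0 = 0" "f (Suc M) = 0"
      using SN M k(2) by (simp_all add: f_def vol_def S_def)
    then show ?thesis
      using summation_by_parts[of f "\<lambda>i. q (s i)" M] by simp
  qed
  finally have Z: "(\<Sum>v\<in>verts G. mu G v * (x v - m)\<^sup>2) = (\<Sum>i<M. f (Suc i) * (q (s i) - q (s (Suc i))))" .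
  have "threshold_conductance G x * (\<Sum>v\<in>verts G. mu G v * (x v - m)\<^sup>2)
      = (\<Sum>i<M. threshold_conductance G x * f (Suc i) * (q (s i) - q (s (Suc i))))"
    unfolding Z by (simp add: sum_distrib_left mult.assoc)
  also have "\<dots> \<le> (\<Sum>i<M. vol_boundary G (S (Suc i)) * (q (s i) - q (s (Suc i))))"
  proof (rule sum_mono)
    fix i assume "i \<in> {..<M}"
    then have i: "Suc i < N" using M by simp
    show "threshold_conductance G x * f (Suc i) * (q (s i) - q (s (Suc i)))
      \<le> vol_boundary G (S (Suc i)) * (q (s i) - q (s (Suc i)))"
    \<comment> \<open>Only at a strict drop of \<open>x\<close> is the prefix known to be a
      threshold set; at a tie the factor \<open>q (s i) - q (s (Suc i))\<close> is 0.\<close>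
    proof (cases "x (s (Suc i)) < x (s i)")
      case True
      have "threshold_set G x (x (s (Suc i))) = S (Suc i)"
      proof (intro equalityI subsetI)
        fix v assume "v \<in> threshold_set G x (x (s (Suc i)))"
        then have v: "v \<in> verts G" "x (s (Suc i)) < x v" by (auto simp: threshold_set_def)
        then obtain j where j: "j < N" "v = s j" using all by (auto simp: N_def)
        then have "j < Suc i"
          using x[of "Suc i" j] v(2) by (fastforce simp: N_def intro: leI)
        then show "v \<in> S (Suc i)" using j by (simp add: S_def)
      next
        fix v assume "v \<in> S (Suc i)"
        then obtain j where j: "j \<le> i" "v = s j" by (auto simp: S_def less_Suc_eq_le)
        then have "x (s i) \<le> x v" using x[of j i] i by (simp add: N_def)
        then show "v \<in> threshold_set G x (x (s (Suc i)))"
          using True verts[of j] i j by (simp add: threshold_set_def N_def)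
      qed
      then have "threshold_conductance G x * f (Suc i) \<le> vol_boundary G (S (Suc i))"
        using threshold_conductance_mult_le[of "s (Suc i)" "s i" x] True verts i f_min[of "Suc i"]
        by (simp add: N_def)
      then show ?thesis
        using q_step[OF i] by (intro mult_right_mono) simp_all
    next
      case False
      then have "x (s (Suc i)) = x (s i)"
        using x[of i "Suc i"] i by (simp add: N_def)
      then show ?thesis by (simp add: q_def)
    qed
  qed
  also have "\<dots> = (\<Sum>e\<in>edges G. scale G e * (\<Sum>v\<in>verts G. greedy G s e v * q v))"
  proof -
    have "(\<Sum>i<M. vol_boundary G (S (Suc i)) * (q (s i) - q (s (Suc i))))
      = (\<Sum>e\<in>edges G. \<Sum>i<M. scale G e * cut G e (S (Suc i) \<inter> e) * (q (s i) - q (s (Suc i))))"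
      unfolding vol_boundary_def sum_distrib_right by (rule sum.swap)
    also have "\<dots> = (\<Sum>e\<in>edges G. scale G e * (\<Sum>v\<in>verts G. greedy G s e v * q v))"
      using M by (intro sum.cong)
        (simp_all add: greedy_by_parts[OF s] sum_distrib_left mult.assoc S_def N_def)
    finally show ?thesis .
  qed
  finally show thesis
    by (intro that[of m]) (simp add: q_def)
qed

text \<open>By the Lipschitz bound \<open>2 * M * x v\<close> falls along \<open>s\<close> at least
  as fast as the signed square, and the greedy vector preserves this comparison. As \<open>M\<close>
  controls \<open>x v - m\<close> on \<open>e\<close> only, the signed square is first truncated,
  which is invisible to a vector supported on \<open>e\<close>.\<close>

lemma greedy_signed_square_le:
  assumes s: "bij_betw s {..<num_verts G} (verts G)"
    and x: "\<And>i j. \<lbrakk>i \<le> j; j < num_verts G\<rbrakk> \<Longrightarrow> x (s j) \<le> x (s i)"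
    and e: "e \<in> edges G" and M: "\<And>v. v \<in> e \<Longrightarrow> \<bar>x v - m\<bar> \<le> M"
  shows "(\<Sum>v\<in>verts G. greedy G s e v * ((x v - m) * \<bar>x v - m\<bar>))
    \<le> 2 * M * (\<Sum>v\<in>verts G. greedy G s e v * x v)"
proof -
  define z where "z v = max (- M) (min M (x v - m))" for v
  \<comment> \<open>An empty edge would have only the cut value 0, against the normalisation to
    maximum 1; a vertex of \<open>e\<close> then shows \<open>0 \<le> M\<close>.\<close>
  have "e \<noteq> {}"
    using cut_normalized[OF e] cut_empty[OF e] by auto
  then have M0: "0 \<le> M"
    using M by (metis abs_ge_zero all_not_in_conv order_trans)
  have "0 \<le> (\<Sum>v\<in>verts G. greedy G s e v * (2 * M * x v - z v * \<bar>z v\<bar>))"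
  proof (rule greedy_monotone_nonneg[OF s e])
    fix i assume "Suc i < num_verts G"
    then have le: "x (s (Suc i)) \<le> x (s i)" using x by simp
    have "z (s i) * \<bar>z (s i)\<bar> - z (s (Suc i)) * \<bar>z (s (Suc i))\<bar> \<le> 2 * M * (z (s i) - z (s (Suc i)))"
      by (rule signed_square_lipschitz) (use le M0 in \<open>auto simp: z_def\<close>)
    also have "\<dots> \<le> 2 * M * (x (s i) - x (s (Suc i)))"
      using le M0 by (intro mult_left_mono) (auto simp: z_def)
    finally show "2 * M * x (s (Suc i)) - z (s (Suc i)) * \<bar>z (s (Suc i))\<bar>
      \<le> 2 * M * x (s i) - z (s i) * \<bar>z (s i)\<bar>"
      by (simp add: algebra_simps)
  qed
  moreover have "greedy G s e v * (z v * \<bar>z v\<bar>) = greedy G s e v * ((x v - m) * \<bar>x v - m\<bar>)" for v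
  proof (cases "v \<in> e")
    case True
    then have "z v = x v - m" using M[of v] by (auto simp: z_def)
    then show ?thesis by simp
  next
    case False
    then show ?thesis
      using base_polytope_vanishes[OF e greedy_in_base_polytope[OF s e]] by simp
  qed
  ultimately have "0 \<le> (\<Sum>v\<in>verts G. greedy G s e v * (2 * M * x v)
      - greedy G s e v * ((x v - m) * \<bar>x v - m\<bar>))"
    by (simp only: right_diff_distrib)
  then show ?thesis
    by (simp add: sum_subtractf sum_distrib_left mult.left_commute)
qed

text \<open>Exchanging the sums gives \<open>f v\<close> the weight \<open>degree G v\<close>, to
  which \<open>tau_upper\<close> applies.\<close>

lemma sum_edges_le_tau:
  assumes "\<And>v. 0 \<le> f v"
  shows "(\<Sum>e\<in>edges G. scale G e * (\<Sum>v\<in>e. f v)) \<le> tau G * (\<Sum>v\<in>verts G. mu G v * f v)"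
proof -
  have "(\<Sum>e\<in>edges G. scale G e * (\<Sum>v\<in>e. f v))
      = (\<Sum>e\<in>edges G. \<Sum>v\<in>verts G. if v \<in> e then scale G e * f v else 0)"
  proof (rule sum.cong[OF refl])
    fix e assume "e \<in> edges G"
    then have "verts G \<inter> e = e" using edge_subset by auto
    then show "scale G e * (\<Sum>v\<in>e. f v) = (\<Sum>v\<in>verts G. if v \<in> e then scale G e * f v else 0)"
      by (simp add: sum_distrib_left flip: sum.inter_restrict)
  qed
  also have "\<dots> = (\<Sum>v\<in>verts G. \<Sum>e\<in>edges G. if v \<in> e then scale G e * f v else 0)"
    by (rule sum.swap)
  also have "\<dots> = (\<Sum>v\<in>verts G. degree G v * f v)"
    unfolding degree_def sum_distrib_right by (simp add: sum.inter_filter)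
  also have "\<dots> \<le> (\<Sum>v\<in>verts G. tau G * mu G v * f v)"
    using assms by (intro sum_mono mult_right_mono tau_upper) auto
  finally show ?thesis by (simp add: sum_distrib_left mult.assoc)
qed

text \<open>The level set bound and the bound on signed squares enclose the same sum, and
  Cauchy-Schwarz over the edges gives \<open>c * Z \<le> 2 * sqrt (tau G * Z * F)\<close>, where
  \<open>c\<close> is the threshold conductance. Dividing by \<open>Z\<close> and using
  \<open>D \<le> Z\<close> finishes the argument.\<close>

lemma threshold_conductance_bound:
  assumes mean: "(\<Sum>v\<in>verts G. mu G v * x v) = 0"
    and pos: "0 < (\<Sum>v\<in>verts G. mu G v * (x v)\<^sup>2)"
    and B: "\<And>e y. \<lbrakk>e \<in> edges G; y \<in> extreme_points (base_polytope G e)\<rbrakk>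
      \<Longrightarrow> (\<Sum>v\<in>verts G. y v * x v)\<^sup>2 \<le> B e"
  shows "threshold_conductance G x
    \<le> 2 * sqrt (tau G * (\<Sum>e\<in>edges G. scale G e * B e) / (\<Sum>v\<in>verts G. mu G v * (x v)\<^sup>2))"
proof -
  obtain s where s: "bij_betw s {..<num_verts G} (verts G)"
    and x: "\<And>i j. \<lbrakk>i \<le> j; j < num_verts G\<rbrakk> \<Longrightarrow> x (s j) \<le> x (s i)"
    using obtain_decreasing_enumeration[OF finite_verts, of x] by (metis card_verts)
  have "verts G \<noteq> {}" using pos by auto
  then obtain m where m: "threshold_conductance G x * (\<Sum>v\<in>verts G. mu G v * (x v - m)\<^sup>2)
      \<le> (\<Sum>e\<in>edges G. scale G e * (\<Sum>v\<in>verts G. greedy G s e v * ((x v - m) * \<bar>x v - m\<bar>)))"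
    using level_set_lower_bound[where x = x, OF s] x by blast
  define D where "D = (\<Sum>v\<in>verts G. mu G v * (x v)\<^sup>2)"
  define Z where "Z = (\<Sum>v\<in>verts G. mu G v * (x v - m)\<^sup>2)"
  define F where "F = (\<Sum>e\<in>edges G. scale G e * B e)"
  \<comment> \<open>The Euclidean norm of \<open>x - m\<close> on \<open>e\<close>. It serves as the
    bound \<open>M\<close> for the edge, and its squares can be summed by
    \<open>sum_edges_le_tau\<close>.\<close>
  define r where "r e = sqrt (\<Sum>v\<in>e. (x v - m)\<^sup>2)" for e
  define y where "y e = (\<Sum>v\<in>verts G. greedy G s e v * x v)" for e
  have D: "0 < D" using pos by (simp add: D_def)
  \<comment> \<open>The second moment is smallest about the mean, which is 0 here.\<close>
  have "Z = D - 2 * m * (\<Sum>v\<in>verts G. mu G v * x v) + m\<^sup>2 * (\<Sum>v\<in>verts G. mu G v)"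
    unfolding Z_def D_def
    by (simp add: power2_diff sum_distrib_left sum.distrib sum_subtractf distrib_left
        sum_distrib_right right_diff_distrib mult_ac)
  also have "\<dots> \<ge> D"
    using mean vol_nonneg[of "verts G"] by (simp add: vol_def)
  finally have DZ: "D \<le> Z" .
  have scale_nonneg: "0 \<le> scale G e" if "e \<in> edges G" for e
    using scale_pos[OF that] by simp
  have yB: "(y e)\<^sup>2 \<le> B e" if "e \<in> edges G" for e
    using B[OF that greedy_extreme[OF s that]] by (simp add: y_def)
  have yF: "(\<Sum>e\<in>edges G. scale G e * (y e)\<^sup>2) \<le> F"
    unfolding F_def by (intro sum_mono mult_left_mono yB scale_nonneg)
  have yF0: "0 \<le> (\<Sum>e\<in>edges G. scale G e * (y e)\<^sup>2)"
    by (intro sum_nonneg mult_nonneg_nonneg scale_nonneg) auto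
  have rZ: "(\<Sum>e\<in>edges G. scale G e * (r e)\<^sup>2) \<le> tau G * Z"
    using sum_edges_le_tau[of "\<lambda>v. (x v - m)\<^sup>2"] by (simp add: r_def Z_def sum_nonneg)
  have rZ0: "0 \<le> (\<Sum>e\<in>edges G. scale G e * (r e)\<^sup>2)"
    by (intro sum_nonneg mult_nonneg_nonneg scale_nonneg) auto
  have "threshold_conductance G x * Z
      \<le> (\<Sum>e\<in>edges G. scale G e * (\<Sum>v\<in>verts G. greedy G s e v * ((x v - m) * \<bar>x v - m\<bar>)))"
    using m by (simp add: Z_def)
  also have "\<dots> \<le> (\<Sum>e\<in>edges G. scale G e * (2 * r e * y e))"
  proof (intro sum_mono mult_left_mono scale_nonneg)
    fix e assume e: "e \<in> edges G"
    have "\<bar>x v - m\<bar> \<le> r e" if "v \<in> e" for v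
      unfolding r_def using that finite_edge[OF e] member_le_sum[of v e "\<lambda>v. (x v - m)\<^sup>2"]
      by (intro real_le_rsqrt) simp
    with x show "(\<Sum>v\<in>verts G. greedy G s e v * ((x v - m) * \<bar>x v - m\<bar>)) \<le> 2 * r e * y e"
      unfolding y_def by (intro greedy_signed_square_le[OF s _ e])
  qed
  also have "\<dots> = 2 * (\<Sum>e\<in>edges G. (sqrt (scale G e) * r e) * (sqrt (scale G e) * y e))"
    unfolding sum_distrib_left
    by (intro sum.cong) (simp_all add: algebra_simps scale_nonneg flip: power2_eq_square)
  also have "\<dots> \<le> 2 * sqrt ((tau G * Z) * F)"
  proof -
    have "(\<Sum>e\<in>edges G. (sqrt (scale G e) * r e) * (sqrt (scale G e) * y e))\<^sup>2
        \<le> (\<Sum>e\<in>edges G. (sqrt (scale G e) * r e)\<^sup>2) * (\<Sum>e\<in>edges G. (sqrt (scale G e) * y e)\<^sup>2)"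
      by (rule Cauchy_Schwarz_ineq_sum)
    also have "\<dots> = (\<Sum>e\<in>edges G. scale G e * (r e)\<^sup>2) * (\<Sum>e\<in>edges G. scale G e * (y e)\<^sup>2)"
      by (simp add: power_mult_distrib scale_nonneg)
    also have "\<dots> \<le> (tau G * Z) * F"
      using yF yF0 rZ rZ0 by (intro mult_mono) linarith+
    finally show ?thesis by (simp add: real_le_rsqrt)
  qed
  finally have main: "threshold_conductance G x * Z \<le> 2 * sqrt ((tau G * Z) * F)" .
  have nonneg: "0 \<le> tau G * F"
  proof -
    have "0 \<le> tau G * Z" using rZ rZ0 by linarith
    then have "0 \<le> tau G" using D DZ by (simp add: zero_le_mult_iff)
    then show ?thesis using yF yF0 by simp
  qed
  have "sqrt ((tau G * Z) * F) = sqrt (tau G * F / Z) * Z"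
    using D DZ by (simp add: real_sqrt_mult real_sqrt_divide field_simps)
  then have "threshold_conductance G x \<le> 2 * sqrt (tau G * F / Z)"
    using main D DZ by simp
  also have "\<dots> \<le> 2 * sqrt (tau G * F / D)"
    using D DZ nonneg by (simp add: divide_left_mono)
  finally show ?thesis by (simp add: F_def D_def)
qed

section \<open>The SDP optimum and the Cheeger constant\<close>

text \<open>The centred and normalised indicator of an optimal cut, placed in the first row of a
  matrix, is feasible; its objective is at most twice the conductance of the cut.\<close>

lemma sdp_objective_le_cheeger:
  assumes opt: "sdp_optimal G n X \<eta>"
  shows "sdp_objective G \<eta> \<le> 2 * cheeger G"
proof -
  have feas: "sdp_feasible G n X \<eta>"
    and min: "\<And>X' \<eta>'. sdp_feasible G n X' \<eta>' \<Longrightarrow> sdp_objective G \<eta> \<le> sdp_objective G \<eta>'"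
    using opt by (auto simp: sdp_optimal_def)
  have norm1: "(\<Sum>v\<in>verts G. mu G v * sq_norm n (\<lambda>i. X i v)) = 1"
    and mean0: "\<And>i. i \<in> {1..n} \<Longrightarrow> (\<Sum>v\<in>verts G. mu G v * X i v) = 0"
    using feas by (auto simp: sdp_feasible_def)
  have n: "1 \<le> n"
    using norm1 by (cases n) (auto simp: sq_norm_def)
  \<comment> \<open>The minimum in \<open>cheeger\<close> needs a proper cut. With a single vertex
    the centring constraint would force a zero column, against the normalisation.\<close>
  have "\<exists>S. S \<noteq> {} \<and> S \<subset> verts G"
  proof (rule ccontr)
    assume none: "\<not> (\<exists>S. S \<noteq> {} \<and> S \<subset> verts G)"
    have "verts G \<noteq> {}" using norm1 by auto
    then obtain v where v: "v \<in> verts G" by auto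
    with none have V: "verts G = {v}" by blast
    have "X i v = 0" if "i \<in> {1..n}" for i
      using mean0[OF that] mu_pos[OF v] V by simp
    then have "sq_norm n (\<lambda>i. X i v) = 0" by (simp add: sq_norm_def)
    then show False using norm1 V by simp
  qed
  then have "cheeger G \<in> conductance G ` {S. S \<noteq> {} \<and> S \<subset> verts G}"
    unfolding cheeger_def
    by (intro Min_in) (auto intro!: finite_imageI finite_subset[OF _ finite_Pow_iff[THEN iffD2, OF finite_verts]])
  then obtain S where S: "S \<noteq> {}" "S \<subset> verts G" "cheeger G = conductance G S" by auto
  define a where "a = vol G S"
  define b where "b = vol G (verts G - S)"
  have a: "0 < a" using S by (auto simp: a_def intro!: vol_pos)
  have b: "0 < b" using S by (auto simp: b_def intro!: vol_pos)
  have volV: "vol G (verts G) = a + b"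
    using vol_complement[of S] S by (auto simp: a_def b_def)
  \<comment> \<open>The weighted sum of squares of the centred indicator
    \<open>indicator S v - a / (a + b)\<close>.\<close>
  define p where "p = a * b / (a + b)"
  have p: "0 < p" using a b by (simp add: p_def)
  define x where "x v = (indicator S v - a / (a + b)) / sqrt p" for v
  define X' where "X' i v = (if i = (1::nat) then x v else 0)" for i v
  define \<eta>' where "\<eta>' e = cut G e (S \<inter> e) / sqrt p" for e
  have SV: "verts G \<inter> S = S" using S by auto
  have sum_ind: "(\<Sum>v\<in>verts G. f v * indicator S v) = (\<Sum>v\<in>S. f v)" for f :: "nat \<Rightarrow> real"
    using SV by (simp add: Int_def)
  have mean: "(\<Sum>v\<in>verts G. mu G v * x v) = 0"
  proof -
    have "(\<Sum>v\<in>verts G. mu G v * x v)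
        = ((\<Sum>v\<in>verts G. mu G v * indicator S v) - vol G (verts G) * (a / (a + b))) / sqrt p"
      by (simp only: x_def vol_def sum_divide_distrib sum_distrib_right sum_subtractf
          right_diff_distrib diff_divide_distrib times_divide_eq_right)
    also have "\<dots> = 0"
      using a b by (simp add: sum_ind volV flip: vol_def a_def)
    finally show ?thesis .
  qed
  have norm: "(\<Sum>v\<in>verts G. mu G v * (x v)\<^sup>2) = 1"
  proof -
    have "((indicator S v - r) / sqrt p)\<^sup>2 = (indicator S v * (1 - 2 * r) + r\<^sup>2) / p" for v r
      using p by (cases "v \<in> S") (simp_all add: power_divide power2_diff)
    then have sq: "(x v)\<^sup>2 = (indicator S v * (1 - 2 * (a / (a + b))) + (a / (a + b))\<^sup>2) / p" for v
      by (simp only: x_def)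
    have "(\<Sum>v\<in>verts G. mu G v * (x v)\<^sup>2)
        = ((\<Sum>v\<in>verts G. mu G v * indicator S v) * (1 - 2 * (a / (a + b)))
            + vol G (verts G) * (a / (a + b))\<^sup>2) / p"
      unfolding sq vol_def
      by (simp only: sum_divide_distrib sum_distrib_right sum.distrib distrib_left
          add_divide_distrib mult.assoc times_divide_eq_right)
    also have "\<dots> = (a * (1 - 2 * (a / (a + b))) + (a + b) * (a / (a + b))\<^sup>2) / p"
      by (simp add: sum_ind volV flip: vol_def a_def)
    also have "\<dots> = 1"
    proof -
      have "(a + b) * (a / (a + b))\<^sup>2 = a * (a / (a + b))"
        using a b by (simp add: power2_eq_square)
      then have "a * (1 - 2 * (a / (a + b))) + (a + b) * (a / (a + b))\<^sup>2 = a * (1 - a / (a + b))"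
        by (simp add: algebra_simps)
      also have "\<dots> = p"
        using a b by (simp add: p_def field_simps)
      finally show ?thesis using p by simp
    qed
    finally show ?thesis .
  qed
  have single: "(\<Sum>i\<in>{1..n}. (if i = 1 then c else 0)) = c" for c :: real
    using n by simp
  have "sdp_feasible G n X' \<eta>'"
    unfolding sdp_feasible_def
  proof (intro conjI ballI)
    fix e y assume e: "e \<in> edges G" and "y \<in> extreme_points (base_polytope G e)"
    then have y: "y \<in> base_polytope G e" by (simp add: extreme_points_def)
    have sum0: "(\<Sum>v\<in>verts G. y v) = 0"
      and le: "\<And>T. T \<subseteq> verts G \<Longrightarrow> (\<Sum>v\<in>T. y v) \<le> cut G e (T \<inter> e)"
      using y by (auto simp: base_polytope_def)
    have "(\<Sum>v\<in>verts G - S. y v) = - (\<Sum>v\<in>S. y v)"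
      using S sum0 by (subst sum_diff) (auto intro: finite_subset)
    \<comment> \<open>The constraints of \<open>S\<close> and of its complement bound the sum from
      both sides, by the same value because the cut is symmetric.\<close>
    then have "\<bar>\<Sum>v\<in>S. y v\<bar> \<le> cut G e (S \<inter> e)"
      using le[of S] le[of "verts G - S"] cut_complement[OF e, of S] S by auto
    then have sq: "(\<Sum>v\<in>S. y v)\<^sup>2 \<le> (cut G e (S \<inter> e))\<^sup>2"
      using abs_le_square_iff cut_nonneg[OF e, of S] by fastforce
    have "(\<Sum>v\<in>verts G. x v * y v) = (\<Sum>v\<in>S. y v) / sqrt p"
    proof -
      have "x v * y v = (y v * indicator S v - a / (a + b) * y v) / sqrt p" for v
        unfolding x_def by (simp add: right_diff_distrib mult.commute)
      then have "(\<Sum>v\<in>verts G. x v * y v)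
          = ((\<Sum>v\<in>verts G. y v * indicator S v) - a / (a + b) * (\<Sum>v\<in>verts G. y v)) / sqrt p"
        by (simp only: sum_subtractf flip: sum_divide_distrib sum_distrib_left)
      then show ?thesis by (simp add: sum_ind sum0)
    qed
    moreover have "sq_norm n (mat_vec G X' y) = (\<Sum>v\<in>verts G. x v * y v)\<^sup>2"
    proof -
      have "(mat_vec G X' y i)\<^sup>2 = (if i = 1 then (\<Sum>v\<in>verts G. x v * y v)\<^sup>2 else 0)" for i
        by (simp add: mat_vec_def X'_def)
      then show ?thesis using n by (simp add: sq_norm_def)
    qed
    ultimately show "sq_norm n (mat_vec G X' y) \<le> (\<eta>' e)\<^sup>2"
      using sq p by (simp add: \<eta>'_def power_divide divide_right_mono)
  next
    have "sq_norm n (\<lambda>i. X' i v) = (x v)\<^sup>2" for v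
    proof -
      have "(X' i v)\<^sup>2 = (if i = 1 then (x v)\<^sup>2 else 0)" for i by (simp add: X'_def)
      then show ?thesis using n by (simp add: sq_norm_def)
    qed
    then show "(\<Sum>v\<in>verts G. mu G v * sq_norm n (\<lambda>i. X' i v)) = 1"
      using norm by simp
  next
    show "(\<Sum>v\<in>verts G. mu G v * X' i v) = 0" for i
      using mean by (cases "i = 1") (simp_all add: X'_def)
  qed
  then have "sdp_objective G \<eta> \<le> sdp_objective G \<eta>'" by (rule min)
  also have "\<dots> \<le> vol_boundary G S / p"
    unfolding sdp_objective_def vol_boundary_def sum_divide_distrib
  proof (rule sum_mono)
    fix e assume e: "e \<in> edges G"
    \<comment> \<open>Normalised cut values lie between 0 and 1.\<close>
    have "(cut G e (S \<inter> e))\<^sup>2 \<le> cut G e (S \<inter> e)"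
      unfolding power2_eq_square
      using mult_left_le cut_nonneg[OF e] cut_le_one[OF e] by blast
    then show "scale G e * (\<eta>' e)\<^sup>2 \<le> scale G e * cut G e (S \<inter> e) / p"
      using scale_pos[OF e] p by (simp add: \<eta>'_def power_divide divide_right_mono mult_left_mono)
  qed
  also have "\<dots> \<le> vol_boundary G S * (2 / min a b)"
  proof -
    \<comment> \<open>Indeed \<open>1 / p = 1 / a + 1 / b\<close>.\<close>
    have "1 / p \<le> 2 / min a b"
      using a b by (simp add: p_def field_simps min_def)
    then have "vol_boundary G S * (1 / p) \<le> vol_boundary G S * (2 / min a b)"
      using vol_boundary_nonneg by (rule mult_left_mono)
    then show ?thesis by simp
  qed
  also have "\<dots> = 2 * cheeger G"
    using S by (simp add: conductance_def a_def b_def)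
  finally show ?thesis .
qed


section \<open>Measurability of the success event\<close>

text \<open>There are finitely many threshold sets, so the infimum is attained, and a threshold can
  be lowered to the largest entry not above it without changing the set. The event becomes a finite
  combination of comparisons between entries of \<open>x\<close>.\<close>

lemma threshold_conductance_le_iff:
  "nonconstant G x \<and> threshold_conductance G x \<le> K \<longleftrightarrow>
    (\<exists>u\<in>verts G. \<exists>w\<in>verts G. x u < x w \<and> conductance G (threshold_set G x (x u)) \<le> K)"
proof (intro iffI; elim conjE bexE)
  fix u w assume uw: "u \<in> verts G" "w \<in> verts G" "x u < x w"
    and le: "conductance G (threshold_set G x (x u)) \<le> K"
  have "Min (x ` verts G) \<le> x u" "x w \<le> Max (x ` verts G)"
    using uw(1,2) by simp_all
  then have "threshold_conductance G x \<le> K"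
    using uw(3) by (intro order_trans[OF threshold_conductance_le le]) simp
  then show "nonconstant G x \<and> threshold_conductance G x \<le> K"
    using uw by (force simp: nonconstant_def)
next
  assume non: "nonconstant G x" and le: "threshold_conductance G x \<le> K"
  define I where "I = {Min (x ` verts G)..<Max (x ` verts G)}"
  define A where "A = (\<lambda>\<theta>. conductance G (threshold_set G x \<theta>)) ` I"
  obtain u w where uw: "u \<in> verts G" "w \<in> verts G" "x u < x w"
    using non unfolding nonconstant_def by (metis linorder_neq_iff)
  have "Min (x ` verts G) \<le> x u" "x w \<le> Max (x ` verts G)"
    using uw by simp_all
  then have "Min (x ` verts G) < Max (x ` verts G)" using uw(3) by linarith
  then have "I \<noteq> {}" by (simp add: I_def)
  then have "A \<noteq> {}" by (simp add: A_def)
  have "finite A"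
    by (rule finite_subset[of _ "conductance G ` Pow (verts G)"]) (auto simp: A_def threshold_set_def)
  with \<open>A \<noteq> {}\<close> have "Inf A \<in> A"
    by (simp add: cInf_eq_Min)
  then obtain \<theta> where \<theta>: "\<theta> \<in> I" "conductance G (threshold_set G x \<theta>) \<le> K"
    using le by (auto simp: threshold_conductance_def A_def I_def)
  define L where "L = {v \<in> verts G. x v \<le> \<theta>}"
  have V: "x ` verts G \<noteq> {}" "finite (x ` verts G)" using uw by auto
  obtain v0 where v0: "v0 \<in> verts G" "x v0 = Min (x ` verts G)"
    using Min_in[OF V(2,1)] by auto
  obtain w where w: "w \<in> verts G" "x w = Max (x ` verts G)"
    using Max_in[OF V(2,1)] by auto
  have L: "finite (x ` L)" "x ` L \<noteq> {}"
    using v0 \<theta>(1) by (auto simp: L_def I_def)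
  obtain u where u: "u \<in> L" "x u = Max (x ` L)"
    using Max_in[OF L] by auto
  have "threshold_set G x (x u) = threshold_set G x \<theta>"
  proof -
    have "x v \<le> x u" if "v \<in> verts G" "x v \<le> \<theta>" for v
      using that L u(2) by (auto simp: L_def)
    then show ?thesis
      using u(1) by (force simp: threshold_set_def L_def)
  qed
  moreover have "u \<in> verts G" "x u < x w"
    using u(1) w(2) \<theta>(1) by (auto simp: L_def I_def)
  ultimately show "\<exists>u\<in>verts G. \<exists>w\<in>verts G. x u < x w \<and> conductance G (threshold_set G x (x u)) \<le> K"
    using w(1) \<theta>(2) by auto
qed

text \<open>Quantifying over the finitely many candidates \<open>T\<close> for the threshold set
  leaves only comparisons of two entries of the rounded vector, which are measurable.\<close>

lemma sets_threshold_event: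
  "{g \<in> space (gaussian n). nonconstant G (rounding n X g) \<and>
      threshold_conductance G (rounding n X g) \<le> K} \<in> sets (gaussian n)"
proof -
  have "conductance G (threshold_set G x (x u)) \<le> K \<longleftrightarrow>
    (\<exists>T\<in>{T \<in> Pow (verts G). conductance G T \<le> K}. \<forall>v\<in>verts G. v \<in> T \<longleftrightarrow> x u < x v)" (is "?L \<longleftrightarrow> ?R")
    for x :: "nat \<Rightarrow> real" and u
  proof
    show "?R" if "?L"
      using that by (intro bexI[of _ "threshold_set G x (x u)"]) (auto simp: threshold_set_def)
    show "?L" if "?R"
    proof -
      from that obtain T where "T \<subseteq> verts G" "conductance G T \<le> K"
        "\<forall>v\<in>verts G. v \<in> T \<longleftrightarrow> x u < x v" by auto
      moreover from this have "threshold_set G x (x u) = T"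
        by (auto simp: threshold_set_def)
      ultimately show ?thesis by simp
    qed
  qed
  note eq = this
  have pred: "Measurable.pred (gaussian n) (\<lambda>g. rounding n X g u < rounding n X g v)" for u v
    by measurable
  show ?thesis
    unfolding threshold_conductance_le_iff eq pred_def[symmetric]
    by (intro pred_intros_finite pred_intros_logic pred finite_verts) simp_all
qed

section \<open>Success probability of the rounding\<close>

text \<open>\<open>Q e g\<close> is the squared length of the projection of \<open>g\<close> to the
  span of the columns of \<open>X\<close> in \<open>e\<close>, hence of mean at most
  \<open>card e\<close>. It is chosen before \<open>y\<close>, so one random variable serves all
  extreme points.\<close>

lemma rounding_projection_bound:
  assumes feas: "sdp_feasible G n X \<eta>"
  shows "\<exists>Q. \<forall>e\<in>edges G. integrable (gaussian n) (Q e)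
    \<and> integral\<^sup>L (gaussian n) (Q e) \<le> real (zeta G) \<and> (\<forall>g. 0 \<le> Q e g)
    \<and> (\<forall>y\<in>extreme_points (base_polytope G e). \<forall>g.
        (\<Sum>v\<in>verts G. y v * rounding n X g v)\<^sup>2 \<le> (\<eta> e)\<^sup>2 * Q e g)"
proof (intro bchoice ballI)
  fix e assume e: "e \<in> edges G"
  show "\<exists>Q. integrable (gaussian n) Q \<and> integral\<^sup>L (gaussian n) Q \<le> real (zeta G) \<and> (\<forall>g. 0 \<le> Q g)
    \<and> (\<forall>y\<in>extreme_points (base_polytope G e). \<forall>g.
        (\<Sum>v\<in>verts G. y v * rounding n X g v)\<^sup>2 \<le> (\<eta> e)\<^sup>2 * Q g)"
  proof -
    obtain U k where k: "k \<le> card e" and unit: "\<forall>j<k. sq_norm n (U j) = 1"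
      and proj: "\<forall>y g. (\<Sum>i\<in>{1..n}. (\<Sum>v\<in>e. X i v * y v) * g i)\<^sup>2
        \<le> sq_norm n (\<lambda>i. \<Sum>v\<in>e. X i v * y v) * (\<Sum>j<k. (\<Sum>i\<in>{1..n}. U j i * g i)\<^sup>2)"
      using projection_bound[OF finite_edge[OF e], of n X] by blast
    define Q where "Q g = (\<Sum>j<k. (\<Sum>i\<in>{1..n}. U j i * g i)\<^sup>2)" for g
    have Qint: "integrable (gaussian n) Q"
      unfolding Q_def
      by (intro Bochner_Integration.integrable_sum second_moment_linear unit[rule_format]) simp
    have "integral\<^sup>L (gaussian n) Q = (\<Sum>j<k. 1)"
      unfolding Q_def using second_moment_linear[OF unit[rule_format]]
      by (subst Bochner_Integration.integral_sum) auto
    then have "integral\<^sup>L (gaussian n) Q \<le> real (zeta G)"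
      using k zeta_upper[OF e] by simp
    moreover have "(\<Sum>v\<in>verts G. y v * rounding n X g v)\<^sup>2 \<le> (\<eta> e)\<^sup>2 * Q g"
      if y: "y \<in> extreme_points (base_polytope G e)" for y g
    proof -
      have "y \<in> base_polytope G e" using y by (simp add: extreme_points_def)
      then have supp: "y v = 0" if "v \<notin> e" for v
        using base_polytope_vanishes[OF e _ that] by blast
      have Xy: "mat_vec G X y = (\<lambda>i. \<Sum>v\<in>e. X i v * y v)"
        unfolding mat_vec_def
        by (intro ext sum.mono_neutral_right) (use edge_subset[OF e] supp in auto)
      have "(\<Sum>v\<in>verts G. y v * rounding n X g v) = (\<Sum>i\<in>{1..n}. mat_vec G X y i * g i)"
        unfolding rounding_def mat_vec_def sum_distrib_left sum_distrib_right
        by (subst sum.swap) (simp add: mult_ac)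
      then have "(\<Sum>v\<in>verts G. y v * rounding n X g v)\<^sup>2 \<le> sq_norm n (mat_vec G X y) * Q g"
        unfolding Xy Q_def using proj by simp
      also have "\<dots> \<le> (\<eta> e)\<^sup>2 * Q g"
        using feas e y by (intro mult_right_mono) (auto simp: sdp_feasible_def Q_def intro!: sum_nonneg)
      finally show ?thesis .
    qed
    ultimately show ?thesis
      using Qint by (intro exI[of _ Q]) (auto simp: Q_def intro!: sum_nonneg)
  qed
qed

text \<open>Two bad events cost \<delta>/2 each: \<open>D g \<le> 1 / t\<close>, excluded by the
  small ball estimate, and \<open>W g\<close> above \<open>2 / \<delta>\<close> times its mean bound
  \<open>B\<close>, excluded by Markov. Outside both, the deterministic Cheeger inequality
  applies.\<close>

lemma rounding_success:
  fixes t \<delta> :: real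
  assumes opt: "sdp_optimal G n X \<eta>"
    and "0 < \<delta>" "0 < t" and t: "exp 1 / sqrt (1 + 2 * t) \<le> \<delta> / 2"
  shows "measure (gaussian n) {g \<in> space (gaussian n). nonconstant G (rounding n X g) \<and>
      threshold_conductance G (rounding n X g)
        \<le> 4 * sqrt (t / \<delta>) * sqrt (real (zeta G) * tau G * cheeger G)} \<ge> 1 - \<delta>"
    (is "measure _ ?good \<ge> _")
proof -
  interpret prob_space "gaussian n" by (rule prob_space_gaussian)
  have feas: "sdp_feasible G n X \<eta>" using opt by (simp add: sdp_optimal_def)
  then have norm: "(\<Sum>v\<in>verts G. mu G v * sq_norm n (\<lambda>i. X i v)) = 1"
    and mean: "\<And>i. i \<in> {1..n} \<Longrightarrow> (\<Sum>v\<in>verts G. mu G v * X i v) = 0"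
    by (auto simp: sdp_feasible_def)
  have mean_g: "(\<Sum>v\<in>verts G. mu G v * rounding n X g v) = 0" for g
  proof -
    have "(\<Sum>v\<in>verts G. mu G v * rounding n X g v) = (\<Sum>i\<in>{1..n}. (\<Sum>v\<in>verts G. mu G v * X i v) * g i)"
      unfolding rounding_def sum_distrib_left sum_distrib_right by (subst sum.swap) (simp add: mult_ac)
    also have "\<dots> = 0" by (intro sum.neutral ballI) (use mean in simp)
    finally show ?thesis .
  qed
  obtain Q where Q_all: "\<forall>e\<in>edges G. integrable (gaussian n) (Q e)
    \<and> integral\<^sup>L (gaussian n) (Q e) \<le> real (zeta G) \<and> (\<forall>g. 0 \<le> Q e g)
    \<and> (\<forall>y\<in>extreme_points (base_polytope G e). \<forall>g.
        (\<Sum>v\<in>verts G. y v * rounding n X g v)\<^sup>2 \<le> (\<eta> e)\<^sup>2 * Q e g)"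
    using rounding_projection_bound[OF feas] ..
  have Q: "integrable (gaussian n) (Q e)" "integral\<^sup>L (gaussian n) (Q e) \<le> real (zeta G)" "0 \<le> Q e g"
    and QB: "y \<in> extreme_points (base_polytope G e)
      \<Longrightarrow> (\<Sum>v\<in>verts G. y v * rounding n X g v)\<^sup>2 \<le> (\<eta> e)\<^sup>2 * Q e g" if "e \<in> edges G" for e y g
    using Q_all that by blast+
  define W where "W g = (\<Sum>e\<in>edges G. scale G e * ((\<eta> e)\<^sup>2 * Q e g))" for g
  define D where "D g = (\<Sum>v\<in>verts G. mu G v * (rounding n X g v)\<^sup>2)" for g
  define B where "B = 2 * (real (zeta G) * cheeger G)"
  have scale_nonneg: "0 \<le> scale G e" if "e \<in> edges G" for e
    using scale_pos[OF that] by simp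
  have W0: "0 \<le> W g" for g
    unfolding W_def by (intro sum_nonneg mult_nonneg_nonneg scale_nonneg Q) auto
  have Wint: "integrable (gaussian n) W"
    unfolding W_def by (intro Bochner_Integration.integrable_sum integrable_mult_right Q)
  have "integral\<^sup>L (gaussian n) W = (\<Sum>e\<in>edges G. scale G e * ((\<eta> e)\<^sup>2 * integral\<^sup>L (gaussian n) (Q e)))"
    unfolding W_def using Q(1)
    by (subst Bochner_Integration.integral_sum) (auto intro!: sum.cong)
  also have "\<dots> \<le> (\<Sum>e\<in>edges G. scale G e * ((\<eta> e)\<^sup>2 * real (zeta G)))"
    by (intro sum_mono mult_left_mono scale_nonneg Q) auto
  also have "\<dots> = real (zeta G) * sdp_objective G \<eta>"
    by (simp add: sdp_objective_def sum_distrib_left mult_ac)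
  also have "\<dots> \<le> B"
    using mult_left_mono[OF sdp_objective_le_cheeger[OF opt], of "real (zeta G)"] by (simp add: B_def)
  finally have EW: "integral\<^sup>L (gaussian n) W \<le> B" .
  define bad1 where "bad1 = {g \<in> space (gaussian n). t * D g \<le> 1}"
  define bad2 where "bad2 = {g \<in> space (gaussian n). (2 / \<delta>) * B < W g}"
  have bad1: "bad1 \<in> sets (gaussian n)" "prob bad1 \<le> \<delta> / 2"
  proof -
    show "bad1 \<in> sets (gaussian n)" unfolding bad1_def D_def by measurable
    show "prob bad1 \<le> \<delta> / 2"
      unfolding bad1_def D_def
      by (rule order_trans[OF quadratic_form_small_ball t])
         (use mu_pos norm \<open>0 < t\<close> in \<open>auto intro: less_imp_le\<close>)
  qed
  have bad2: "bad2 \<in> sets (gaussian n)" "prob bad2 \<le> \<delta> / 2"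
  proof -
    show "bad2 \<in> sets (gaussian n)"
      unfolding bad2_def using borel_measurable_integrable[OF Wint] by measurable
    show "prob bad2 \<le> \<delta> / 2"
      using Markov_inequality_scaled[OF Wint W0 EW, of "2 / \<delta>"] \<open>0 < \<delta>\<close> by (simp add: bad2_def)
  qed
  have "verts G \<noteq> {}" using norm by auto
  then obtain v0 where v0: "v0 \<in> verts G" by auto
  have tau: "0 \<le> tau G"
  proof -
    have "0 \<le> degree G v0" by (auto simp: degree_def intro!: sum_nonneg scale_nonneg)
    then have "0 \<le> tau G * mu G v0" using tau_upper[OF v0] by simp
    then show ?thesis using mu_pos[OF v0] by (simp add: zero_le_mult_iff)
  qed
  have "space (gaussian n) - (bad1 \<union> bad2) \<subseteq> ?good"
  proof (intro subsetI CollectI conjI)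
    fix g assume "g \<in> space (gaussian n) - (bad1 \<union> bad2)"
    then have g: "g \<in> space (gaussian n)" "g \<notin> bad1" "g \<notin> bad2"
      by simp_all
    show "g \<in> space (gaussian n)" by (rule g)
    have tD: "1 < t * D g" using g(1,2) by (simp add: bad1_def)
    have WB: "W g \<le> (2 / \<delta>) * B" using g(1,3) by (simp add: bad2_def not_less)
    have "0 < t * D g" using tD by linarith
    then have D: "0 < D g" using \<open>0 < t\<close> by (rule zero_less_mult_pos)
    \<comment> \<open>A constant vector of weighted mean 0 is 0 on the vertices, which contradicts
      \<open>0 < D g\<close>.\<close>
    show "nonconstant G (rounding n X g)"
    proof (rule ccontr)
      assume "\<not> nonconstant G (rounding n X g)"
      then have eq: "rounding n X g v = rounding n X g v0" if "v \<in> verts G" for v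
        using that v0 unfolding nonconstant_def by blast
      have "(\<Sum>v\<in>verts G. mu G v * rounding n X g v) = (\<Sum>v\<in>verts G. mu G v * rounding n X g v0)"
        by (intro sum.cong refl arg_cong2[of _ _ _ _ "(*)"] eq)
      then have "vol G (verts G) * rounding n X g v0 = 0"
        unfolding mean_g by (simp add: vol_def sum_distrib_right)
      then have zero: "rounding n X g v0 = 0"
        using vol_pos[OF order_refl \<open>verts G \<noteq> {}\<close>] by simp
      have "D g = 0"
        unfolding D_def by (intro sum.neutral ballI) (simp only: eq zero, simp)
      then show False using D by simp
    qed
    have "threshold_conductance G (rounding n X g) \<le> 2 * sqrt (tau G * W g / D g)"
      using threshold_conductance_bound[OF mean_g, of g "\<lambda>e. (\<eta> e)\<^sup>2 * Q e g"] D QB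
      by (simp add: W_def D_def)
    also have "\<dots> \<le> 2 * sqrt (tau G * ((2 / \<delta>) * B) * t)"
    proof -
      have "1 / D g \<le> t" using tD D by (simp add: field_simps)
      then have "(tau G * W g) * (1 / D g) \<le> (tau G * ((2 / \<delta>) * B)) * t"
        using WB order_trans[OF W0 WB] W0[of g] tau D
        by (intro mult_mono mult_left_mono mult_nonneg_nonneg[OF tau]) simp_all
      then show ?thesis by simp
    qed
    also have "\<dots> = 4 * sqrt (t / \<delta>) * sqrt (real (zeta G) * tau G * cheeger G)"
    proof -
      \<comment> \<open>One factor 2 comes from Markov and one from the SDP comparison in
        \<open>B\<close>; their product leaves the root as 2 and meets the 2 of the Cheeger
        inequality.\<close>
      have "tau G * ((2 / \<delta>) * B) * t = 4 * ((t / \<delta>) * (real (zeta G) * tau G * cheeger G))"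
        by (simp add: B_def)
      then have "sqrt (tau G * ((2 / \<delta>) * B) * t)
          = 2 * (sqrt (t / \<delta>) * sqrt (real (zeta G) * tau G * cheeger G))"
        by (simp only: real_sqrt_mult real_sqrt_four)
      then show ?thesis by simp
    qed
    finally show "threshold_conductance G (rounding n X g)
      \<le> 4 * sqrt (t / \<delta>) * sqrt (real (zeta G) * tau G * cheeger G)" .
  qed
  then have "prob (space (gaussian n) - (bad1 \<union> bad2)) \<le> prob ?good"
    by (intro finite_measure_mono sets_threshold_event)
  moreover have "prob (space (gaussian n) - (bad1 \<union> bad2)) = 1 - prob (bad1 \<union> bad2)"
    using bad1 bad2 by (intro prob_compl) auto
  moreover have "prob (bad1 \<union> bad2) \<le> prob bad1 + prob bad2"
    using bad1 bad2 by (intro measure_Un_le)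
  ultimately show ?thesis using bad1 bad2 by linarith
qed

end

text \<open>High probability is expressed by an arbitrary failure bound \<delta>, with
  \<open>C\<close> chosen before the hypergraph, the dimension and the SDP solution.\<close>

theorem theorem4p5:
  fixes \<delta> :: real
  assumes "0 < \<delta>"
  shows "\<exists>C>0. \<forall>G n X \<eta>.
    submodular_hypergraph G \<longrightarrow> zeta G \<le> n \<longrightarrow> sdp_optimal G n X \<eta> \<longrightarrow>
    \<P>(g in gaussian n.
        nonconstant G (rounding n X g) \<and>
        threshold_conductance G (rounding n X g)
          \<le> C * sqrt (real (zeta G) * tau G * cheeger G)) \<ge> 1 - \<delta>"
proof -
  \<comment> \<open>Chosen so that \<open>sqrt (1 + 2 * t)\<close> exceeds
    \<open>2 * exp 1 / \<delta>\<close>; the resulting \<open>C\<close> is of order \<delta> to the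
    power -3/2.\<close>
  define t where "t = (2 * exp 1 / \<delta>)\<^sup>2 / 2"
  have t: "0 < t" using assms by (simp add: t_def)
  have "2 * exp 1 / \<delta> \<le> sqrt (1 + 2 * t)"
    by (intro real_le_rsqrt) (simp add: t_def)
  then have small: "exp 1 / sqrt (1 + 2 * t) \<le> \<delta> / 2"
    using assms t by (simp add: field_simps)
  show ?thesis
    using submodular_hypergraph.rounding_success[OF _ _ assms t small] assms t
    by (intro exI[of _ "4 * sqrt (t / \<delta>)"]) auto
qed

end
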